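(* Let $R$ be a commutative ring with identity of characteristic zero (i.e. $R\to R\otimes\mathbb{Q}$ is injective), endowed for every rational prime $p$ with a $p$th power Frobenius endomorphism $\sigma_p:R\to R$, i.e. a ring endomorphism with $\sigma_p(r)\equiv r^p\bmod pR$ for every $r\in R$. Let $\{b_n;\,n\ge0\}$ be a sequence of elements of $R$ with $b_0=1$, put $f(x)=\sum_{n=1}^\infty\frac{b_{n-1}}{n}x^n\in(R\otimes\mathbb{Q})[[x]]$ and $F(x,y)=f^{-1}(f(x)+f(y))$, where $f^{-1}$ is the compositional inverse. Then $F(x,y)\in R[[x,y]]$ if and only if for every prime $p$ the $p$-sequence $\{c^{(p)}_n;\,n\ge0\}$ associated to $\{b_n;\,n\ge0\}$ (with respect to $\sigma_p$) satisfies $$c^{(p)}_{mp^k-1}\in p^kR\quad\text{ for all integers } m>1,\ k\ge0.$$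
   Context: Fix a prime $p$ and write $\sigma=\sigma_p$. For an integer $n\ge 0$ let $\ell(n)=\min\{s\ge 1 : n<p^s\}$ be the length of the $p$-adic expansion of $n$ (so $\ell(0)=1$). For integers $n,m\ge 0$ put $n*m=n+m\,p^{\ell(n)}$ (concatenation of $p$-adic expansions). The $p$-sequence associated to a sequence $\{b_n;\,n\ge0\}$ of elements of $R$ is the sequence of elements of $R$ given, for $n\ge0$, by $$c^{(p)}_n=\sum (-1)^{k-1}\, b_{n_1}\cdot\sigma^{\ell(n_1)}(b_{n_2})\cdot\sigma^{\ell(n_1)+\ell(n_2)}(b_{n_3})\cdots\sigma^{\ell(n_1)+\cdots+\ell(n_{k-1})}(b_{n_k}),$$ where the sum runs over all $k\ge1$ and all tuples $(n_1,\dots,n_k)$ of integers with $n=n_1*\cdots*n_k$, $n_1\ge0$ and $n_2,\dots,n_k>0$ (the term $k=1$ is $b_n$; the operation is associative on such tuples). *)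

theory Defs
  imports "HOL-Computational_Algebra.Formal_Power_Series" "HOL-Computational_Algebra.Primes"
begin

unbundle fps_syntax

section \<open>The ring \<open>R \<otimes> \<rat>\<close>\<close>

text \<open>
  For a commutative ring \<open>R\<close>, not necessarily a domain, \<open>R \<otimes> \<rat>\<close> is realised as the
  localisation of \<open>R\<close> at the positive integers: \<open>r \<otimes> (1/n)\<close> is the class of \<open>(r, n)\<close>. The
  factor \<open>k\<close> in the relation accounts for additive torsion of \<open>R\<close>, so that injectivity
  of \<open>R \<rightarrow> R \<otimes> \<rat>\<close> is a genuine condition on \<open>R\<close> (see \<open>base_to_tensor_eq_0_iff\<close>).
\<close>

definition tensor_rat_rel :: "'a::comm_ring_1 \<times> nat \<Rightarrow> 'a \<times> nat \<Rightarrow> bool" where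
  "tensor_rat_rel x y \<longleftrightarrow> snd x > 0 \<and> snd y > 0 \<and>
     (\<exists>k>0. of_nat k * (fst x * of_nat (snd y)) = of_nat k * (fst y * of_nat (snd x)))"

lemma part_equivp_tensor_rat_rel: "part_equivp (tensor_rat_rel :: 'a::comm_ring_1 \<times> nat \<Rightarrow> _)"
proof (rule part_equivpI)
  show "\<exists>x. tensor_rat_rel x (x :: 'a \<times> nat)"
    by (rule exI[of _ "(0, 1)"]) (auto simp: tensor_rat_rel_def)
  show "symp (tensor_rat_rel :: 'a \<times> nat \<Rightarrow> _)"
    by (auto simp: symp_def tensor_rat_rel_def)
  show "transp (tensor_rat_rel :: 'a \<times> nat \<Rightarrow> _)"
  proof (rule transpI)
    fix x y z :: "'a \<times> nat"
    assume "tensor_rat_rel x y" and "tensor_rat_rel y z"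
    then obtain k l where pos: "snd x > 0" "snd y > 0" "snd z > 0" "k > 0" "l > 0"
      and k: "of_nat k * (fst x * of_nat (snd y)) = of_nat k * (fst y * of_nat (snd x))"
      and l: "of_nat l * (fst y * of_nat (snd z)) = of_nat l * (fst z * of_nat (snd y))"
      by (auto simp: tensor_rat_rel_def)
    have "of_nat (k * l * snd y) * (fst x * of_nat (snd z)) =
        of_nat l * of_nat (snd z) * (of_nat k * (fst x * of_nat (snd y)))"
      by (simp add: algebra_simps)
    also have "\<dots> = of_nat k * of_nat (snd x) * (of_nat l * (fst y * of_nat (snd z)))"
      unfolding k by (simp add: algebra_simps)
    also have "\<dots> = of_nat (k * l * snd y) * (fst z * of_nat (snd x))"
      unfolding l by (simp add: algebra_simps)
    finally show "tensor_rat_rel x z"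
      using pos unfolding tensor_rat_rel_def
      by (intro conjI exI[of _ "k * l * snd y"]) auto
  qed
qed

quotient_type (overloaded) 'a tensor_rat = "'a::comm_ring_1 \<times> nat" / partial: tensor_rat_rel
  by (rule part_equivp_tensor_rat_rel)

text \<open>\<open>tensor_frac r n\<close> is \<open>r \<otimes> (1/n)\<close>; the value at \<open>n = 0\<close> is a dummy.\<close>

lift_definition tensor_frac :: "'a::comm_ring_1 \<Rightarrow> nat \<Rightarrow> 'a tensor_rat"
  is "\<lambda>r n. if n = 0 then (0, 1) else (r, n)"
  by (auto simp: tensor_rat_rel_def)

definition base_to_tensor :: "'a::comm_ring_1 \<Rightarrow> 'a tensor_rat" where
  "base_to_tensor r = tensor_frac r 1"

lemma tensor_frac_cases [cases type: tensor_rat]: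
  obtains (frac) r n where "z = tensor_frac r n" "n > 0"
  by transfer (auto simp: tensor_rat_rel_def)

lemma tensor_frac_eq_iff:
  assumes "m > 0" "n > 0"
  shows "tensor_frac r m = tensor_frac s n \<longleftrightarrow>
    (\<exists>k>0. of_nat k * (r * of_nat n) = of_nat k * (s * of_nat m))"
  using assms by transfer (auto simp: tensor_rat_rel_def)

instantiation tensor_rat :: (comm_ring_1) "{zero, one, plus, uminus, minus, times}"
begin

lift_definition zero_tensor_rat :: "'a tensor_rat" is "(0, 1)"
  by (auto simp: tensor_rat_rel_def)

lift_definition one_tensor_rat :: "'a tensor_rat" is "(1, 1)"
  by (auto simp: tensor_rat_rel_def)

lift_definition plus_tensor_rat :: "'a tensor_rat \<Rightarrow> 'a tensor_rat \<Rightarrow> 'a tensor_rat"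
  is "\<lambda>x y. (fst x * of_nat (snd y) + fst y * of_nat (snd x), snd x * snd y)"
proof -
  fix x x' y y' :: "'a \<times> nat"
  assume "tensor_rat_rel x x'" and "tensor_rat_rel y y'"
  then obtain k l where pos: "snd x > 0" "snd x' > 0" "snd y > 0" "snd y' > 0" "k > 0" "l > 0"
    and k: "of_nat k * (fst x * of_nat (snd x')) = of_nat k * (fst x' * of_nat (snd x))"
    and l: "of_nat l * (fst y * of_nat (snd y')) = of_nat l * (fst y' * of_nat (snd y))"
    by (auto simp: tensor_rat_rel_def)
  have "of_nat (k * l) * ((fst x * of_nat (snd y) + fst y * of_nat (snd x)) * of_nat (snd x' * snd y')) =
      of_nat l * of_nat (snd y) * of_nat (snd y') * (of_nat k * (fst x * of_nat (snd x'))) +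
      of_nat k * of_nat (snd x) * of_nat (snd x') * (of_nat l * (fst y * of_nat (snd y')))"
    by (simp add: algebra_simps)
  also have "\<dots> = of_nat (k * l) * ((fst x' * of_nat (snd y') + fst y' * of_nat (snd x')) * of_nat (snd x * snd y))"
    unfolding k l by (simp add: algebra_simps)
  finally show "tensor_rat_rel (fst x * of_nat (snd y) + fst y * of_nat (snd x), snd x * snd y)
     (fst x' * of_nat (snd y') + fst y' * of_nat (snd x'), snd x' * snd y')"
    using pos unfolding tensor_rat_rel_def fst_conv snd_conv
    by (intro conjI exI[of _ "k * l"]) auto
qed

lift_definition uminus_tensor_rat :: "'a tensor_rat \<Rightarrow> 'a tensor_rat"
  is "\<lambda>x. (- fst x, snd x)"
  by (auto simp: tensor_rat_rel_def)

definition minus_tensor_rat :: "'a tensor_rat \<Rightarrow> 'a tensor_rat \<Rightarrow> 'a tensor_rat"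
  where "x - y = x + - y" for x y :: "'a tensor_rat"

lift_definition times_tensor_rat :: "'a tensor_rat \<Rightarrow> 'a tensor_rat \<Rightarrow> 'a tensor_rat"
  is "\<lambda>x y. (fst x * fst y, snd x * snd y)"
proof -
  fix x x' y y' :: "'a \<times> nat"
  assume "tensor_rat_rel x x'" and "tensor_rat_rel y y'"
  then obtain k l where pos: "snd x > 0" "snd x' > 0" "snd y > 0" "snd y' > 0" "k > 0" "l > 0"
    and k: "of_nat k * (fst x * of_nat (snd x')) = of_nat k * (fst x' * of_nat (snd x))"
    and l: "of_nat l * (fst y * of_nat (snd y')) = of_nat l * (fst y' * of_nat (snd y))"
    by (auto simp: tensor_rat_rel_def)
  have "of_nat (k * l) * ((fst x * fst y) * of_nat (snd x' * snd y')) =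
      (of_nat k * (fst x * of_nat (snd x'))) * (of_nat l * (fst y * of_nat (snd y')))"
    by (simp add: algebra_simps)
  also have "\<dots> = of_nat (k * l) * ((fst x' * fst y') * of_nat (snd x * snd y))"
    unfolding k l by (simp add: algebra_simps)
  finally show "tensor_rat_rel (fst x * fst y, snd x * snd y) (fst x' * fst y', snd x' * snd y')"
    using pos unfolding tensor_rat_rel_def fst_conv snd_conv
    by (intro conjI exI[of _ "k * l"]) auto
qed

instance ..

end

lemma tensor_frac_0: "0 = tensor_frac 0 1"
  and tensor_frac_1: "1 = tensor_frac 1 1"
  unfolding zero_tensor_rat_def one_tensor_rat_def tensor_frac_def by simp_all

lemma tensor_frac_add:
  "m > 0 \<Longrightarrow> n > 0 \<Longrightarrow>
    tensor_frac r m + tensor_frac s n = tensor_frac (r * of_nat n + s * of_nat m) (m * n)"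
  by transfer (auto simp: tensor_rat_rel_def)

lemma tensor_frac_uminus: "- tensor_frac r m = tensor_frac (- r) m"
  by transfer (auto simp: tensor_rat_rel_def)

lemma tensor_frac_mult:
  "m > 0 \<Longrightarrow> n > 0 \<Longrightarrow> tensor_frac r m * tensor_frac s n = tensor_frac (r * s) (m * n)"
  by transfer (auto simp: tensor_rat_rel_def)

lemma tensor_frac_eqI:
  "m > 0 \<Longrightarrow> n > 0 \<Longrightarrow> r * of_nat n = s * of_nat m \<Longrightarrow> tensor_frac r m = tensor_frac s n"
  by (subst tensor_frac_eq_iff) (auto intro!: exI[of _ 1])

instance tensor_rat :: ("{comm_ring_1, ring_char_0}") comm_ring_1
proof
  fix a b c :: "'a tensor_rat"
  obtain r m where a: "a = tensor_frac r m" "m > 0" by (cases a)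
  obtain s n where b: "b = tensor_frac s n" "n > 0" by (cases b)
  obtain t l where c: "c = tensor_frac t l" "l > 0" by (cases c)
  show "a * b * c = a * (b * c)"
    using a b c by (simp add: tensor_frac_mult mult.assoc)
  show "a * b = b * a"
    using a b by (simp add: tensor_frac_mult mult.commute)
  show "1 * a = a"
    using a by (simp add: tensor_frac_1 tensor_frac_mult)
  show "a + b + c = a + (b + c)"
    using a b c by (simp add: tensor_frac_add algebra_simps)
  show "a + b = b + a"
    using a b by (simp add: tensor_frac_add algebra_simps)
  show "0 + a = a"
    using a by (simp add: tensor_frac_0 tensor_frac_add)
  show "- a + a = 0"
    using a by (simp add: tensor_frac_0 tensor_frac_add tensor_frac_uminus) (rule tensor_frac_eqI; simp)
  show "a - b = a + - b"
    by (simp add: minus_tensor_rat_def)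
  show "(a + b) * c = a * c + b * c"
    using a b c
    by (simp add: tensor_frac_add tensor_frac_mult) (rule tensor_frac_eqI; simp add: algebra_simps)
  show "(0 :: 'a tensor_rat) \<noteq> 1"
    by (simp add: tensor_frac_0 tensor_frac_1 tensor_frac_eq_iff)
qed

lemma base_to_tensor_hom:
  "base_to_tensor 0 = 0" "base_to_tensor 1 = 1"
  "base_to_tensor (r + s) = base_to_tensor r + base_to_tensor s"
  "base_to_tensor (r * s) = base_to_tensor r * base_to_tensor s"
  by (simp_all add: base_to_tensor_def tensor_frac_0 tensor_frac_1 tensor_frac_add tensor_frac_mult)

lemma base_to_tensor_of_nat:
  "base_to_tensor (of_nat n :: 'a::{comm_ring_1, ring_char_0}) = of_nat n"
  by (induction n) (simp_all add: base_to_tensor_hom)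

lemma of_nat_mult_tensor_frac:
  fixes r :: "'a::{comm_ring_1, ring_char_0}"
  assumes "n > 0"
  shows "of_nat n * tensor_frac r n = base_to_tensor r"
  using assms
  by (simp add: base_to_tensor_of_nat[symmetric] base_to_tensor_def tensor_frac_mult)
     (rule tensor_frac_eqI; simp)

lemma base_to_tensor_eq_0_iff: "base_to_tensor r = 0 \<longleftrightarrow> (\<exists>n>0. of_nat n * r = 0)"
  by (simp add: base_to_tensor_def tensor_frac_0 tensor_frac_eq_iff)


section \<open>Compositional inverse and substitution in two variables\<close>

text \<open>The library's \<open>fps_inv\<close> is only available over fields.\<close>

definition fps_compinv :: "'a::comm_ring_1 fps \<Rightarrow> 'a fps" where
  "fps_compinv f = (THE g. g $ 0 = 0 \<and> f oo g = fps_X \<and> g oo f = fps_X)"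

text \<open>
  A series in \<open>K[[x, y]]\<close> is an element of \<open>K[[x]][[y]]\<close>, so \<open>h $ j $ i\<close> is the coefficient of
  \<open>x^i y^j\<close>. For \<open>h\<close> without constant term, \<open>fps_subst2 g h\<close> is \<open>g(h(x, y)) = \<Sum>k. g_k h(x, y)^k\<close>;
  as \<open>h^k\<close> has no terms of total degree below \<open>k\<close>, the sum for each coefficient is finite.
\<close>

definition fps_subst2 :: "'a::comm_ring_1 fps \<Rightarrow> 'a fps fps \<Rightarrow> 'a fps fps" where
  "fps_subst2 g h = Abs_fps (\<lambda>j. Abs_fps (\<lambda>i. \<Sum>k\<le>i + j. g $ k * (h ^ k) $ j $ i))"

definition fps_in_x :: "'a::comm_ring_1 fps \<Rightarrow> 'a fps fps" where
  "fps_in_x f = fps_const f"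

definition fps_in_y :: "'a::comm_ring_1 fps \<Rightarrow> 'a fps fps" where
  "fps_in_y f = Abs_fps (\<lambda>j. fps_const (f $ j))"

definition formal_group_law :: "'a::comm_ring_1 fps \<Rightarrow> 'a fps fps" where
  "formal_group_law f = fps_subst2 (fps_compinv f) (fps_in_x f + fps_in_y f)"

definition log_series :: "(nat \<Rightarrow> 'a::comm_ring_1) \<Rightarrow> 'a tensor_rat fps" where
  "log_series b = Abs_fps (\<lambda>n. if n = 0 then 0 else tensor_frac (b (n - 1)) n)"

lemma power_nth_nth_eq_0:
  fixes h :: "'a::comm_ring_1 fps fps"
  assumes "h $ 0 $ 0 = 0" and "i + j < k"
  shows "(h ^ k) $ j $ i = 0"
  using assms(2)
proof (induction k arbitrary: i j)
  case (Suc k)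
  have "h $ j' $ i' * (h ^ k) $ (j - j') $ (i - i') = 0" if "i' \<le> i" "j' \<le> j" for i' j'
  proof (cases "i' = 0 \<and> j' = 0")
    case True
    then show ?thesis using assms(1) by simp
  next
    case False
    then have "(i - i') + (j - j') < k" using that Suc.prems by auto
    then show ?thesis using Suc.IH by simp
  qed
  then show ?case
    by (simp add: fps_mult_nth fps_sum_nth)
qed simp

lemma fps_left_compinv_exists:
  fixes f :: "'a::comm_ring_1 fps"
  assumes "f $ 0 = 0" and "f $ 1 = 1"
  shows "\<exists>g. g $ 0 = 0 \<and> g $ 1 = 1 \<and> g oo f = fps_X"
proof -
  define G where "G = wfrec less_than
    (\<lambda>G n. (fps_X :: 'a fps) $ n - (\<Sum>i<n. G i * (f ^ i) $ n))"
  have G: "G n = fps_X $ n - (\<Sum>i<n. G i * (f ^ i) $ n)" for n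
    unfolding G_def by (subst wfrec) (simp_all add: cut_def)
  have diag: "(f ^ n) $ n = 1" for n
    using startsby_zero_power_nth_same[OF assms(1), of n] assms(2) by simp
  have "(Abs_fps G oo f) $ n = fps_X $ n" for n
  proof -
    have "(Abs_fps G oo f) $ n = (\<Sum>i\<in>insert n {..<n}. G i * (f ^ i) $ n)"
      unfolding fps_compose_nth by (rule sum.cong) auto
    also have "\<dots> = G n + (\<Sum>i<n. G i * (f ^ i) $ n)"
      by (simp add: diag)
    also have "\<dots> = fps_X $ n"
      by (subst G) simp
    finally show ?thesis .
  qed
  moreover have "G 0 = 0" by (subst G) simp
  moreover have "G 1 = 1" by (subst G) (simp add: \<open>G 0 = 0\<close>)
  ultimately show ?thesis
    by (intro exI[of _ "Abs_fps G"]) (simp add: fps_eq_iff)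
qed

lemma fps_compose_truncate:
  fixes c :: "'a::comm_ring_1 fps"
  assumes "c $ 0 = 0" and "n \<le> N"
  shows "(a oo c) $ n = (\<Sum>i\<le>N. a $ i * (c ^ i) $ n)"
  unfolding fps_compose_nth
  by (rule sum.mono_neutral_left)
     (use assms in \<open>auto simp: startsby_zero_power_prefix\<close>)

lemma fps_compose_mult_comm_ring:
  fixes c :: "'a::comm_ring_1 fps"
  assumes c: "c $ 0 = 0"
  shows "(a * b) oo c = (a oo c) * (b oo c)"
proof (rule fps_ext)
  fix n
  have "((a oo c) * (b oo c)) $ n =
      (\<Sum>q\<le>n. (\<Sum>i\<le>n. a $ i * (c ^ i) $ q) * (\<Sum>j\<le>n. b $ j * (c ^ j) $ (n - q)))"
    unfolding fps_mult_nth atLeast0AtMost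
    by (intro sum.cong refl) (simp add: fps_compose_truncate[OF c, of _ n])
  also have "\<dots> = (\<Sum>q\<le>n. \<Sum>i\<le>n. \<Sum>j\<le>n. a $ i * b $ j * ((c ^ i) $ q * (c ^ j) $ (n - q)))"
    by (simp add: sum_product mult_ac)
  also have "\<dots> = (\<Sum>i\<le>n. \<Sum>q\<le>n. \<Sum>j\<le>n. a $ i * b $ j * ((c ^ i) $ q * (c ^ j) $ (n - q)))"
    by (rule sum.swap)
  also have "\<dots> = (\<Sum>i\<le>n. \<Sum>j\<le>n. \<Sum>q\<le>n. a $ i * b $ j * ((c ^ i) $ q * (c ^ j) $ (n - q)))"
    by (intro sum.cong refl sum.swap)
  also have "\<dots> = (\<Sum>i\<le>n. \<Sum>j\<le>n. a $ i * b $ j * (c ^ (i + j)) $ n)"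
    by (simp add: power_add fps_mult_nth sum_distrib_left atLeast0AtMost)
  also have "\<dots> = (\<Sum>(i, j)\<in>{..n} \<times> {..n}. a $ i * b $ j * (c ^ (i + j)) $ n)"
    by (simp add: sum.cartesian_product)
  also have "\<dots> = (\<Sum>(i, j)\<in>{(i, j). i + j \<le> n}. a $ i * b $ j * (c ^ (i + j)) $ n)"
  proof (rule sum.mono_neutral_right)
    show "\<forall>ij\<in>{..n} \<times> {..n} - {(i, j). i + j \<le> n}.
        (case ij of (i, j) \<Rightarrow> a $ i * b $ j * (c ^ (i + j)) $ n) = 0"
      using startsby_zero_power_prefix[OF c] by (simp add: case_prod_beta not_le)
  qed auto
  also have "\<dots> = (\<Sum>k\<le>n. \<Sum>i\<le>k. a $ i * b $ (k - i) * (c ^ (i + (k - i))) $ n)"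
    by (rule sum.triangle_reindex_eq)
  also have "\<dots> = ((a * b) oo c) $ n"
    by (simp add: fps_compose_nth fps_mult_nth sum_distrib_right atLeast0AtMost)
  finally show "((a * b) oo c) $ n = ((a oo c) * (b oo c)) $ n" ..
qed

lemma fps_compose_assoc_comm_ring:
  fixes c :: "'a::comm_ring_1 fps"
  assumes c: "c $ 0 = 0" and b: "b $ 0 = 0"
  shows "a oo (b oo c) = (a oo b) oo c"
proof (rule fps_ext)
  fix n
  have power: "(b oo c) ^ i = (b ^ i) oo c" for i
    by (induction i) (simp_all add: fps_compose_mult_comm_ring[OF c])
  have "(a oo (b oo c)) $ n = (\<Sum>i\<le>n. \<Sum>q\<le>n. a $ i * (b ^ i) $ q * (c ^ q) $ n)"
    by (simp add: fps_compose_nth[of a] power fps_compose_truncate[OF c order_refl]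
        sum_distrib_left mult.assoc atLeast0AtMost)
  also have "\<dots> = (\<Sum>q\<le>n. \<Sum>i\<le>n. a $ i * (b ^ i) $ q * (c ^ q) $ n)"
    by (rule sum.swap)
  also have "\<dots> = ((a oo b) oo c) $ n"
    unfolding fps_compose_truncate[OF c order_refl, of "a oo b"]
    by (intro sum.cong refl) (simp add: fps_compose_truncate[OF b, of _ n] sum_distrib_right)
  finally show "(a oo (b oo c)) $ n = ((a oo b) oo c) $ n" .
qed

lemma fps_compinv:
  fixes f :: "'a::comm_ring_1 fps"
  assumes f: "f $ 0 = 0" "f $ 1 = 1"
  shows "fps_compinv f $ 0 = 0" and "f oo fps_compinv f = fps_X" and "fps_compinv f oo f = fps_X"
proof -
  obtain g where g: "g $ 0 = 0" "g $ 1 = 1" "g oo f = fps_X"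
    using fps_left_compinv_exists[OF f] by blast
  obtain h where h: "h $ 0 = 0" "h oo g = fps_X"
    using fps_left_compinv_exists[OF g(1,2)] by blast
  have "h = h oo (g oo f)"
    using g(3) by simp
  also have "\<dots> = f"
    using fps_compose_assoc_comm_ring[OF f(1) g(1), of h] h(2) f(1) by simp
  finally have right: "f oo g = fps_X"
    using h(2) by simp
  have "g' = g" if "g' $ 0 = 0" "f oo g' = fps_X" for g'
  proof -
    have "g = g oo (f oo g')"
      using that(2) by simp
    also have "\<dots> = g'"
      using fps_compose_assoc_comm_ring[OF that(1) f(1), of g] g(3) that(1) by simp
    finally show ?thesis ..
  qed
  with g right have "\<exists>!g. g $ 0 = 0 \<and> f oo g = fps_X \<and> g oo f = fps_X"
    by blast
  from theI'[OF this]
  show "fps_compinv f $ 0 = 0" and "f oo fps_compinv f = fps_X" and "fps_compinv f oo f = fps_X"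
    unfolding fps_compinv_def by blast+
qed

lemma log_series_0: "log_series b $ 0 = (0 :: 'a::{comm_ring_1, ring_char_0} tensor_rat)"
  and log_series_1: "b 0 = 1 \<Longrightarrow> log_series b $ 1 = (1 :: 'a::{comm_ring_1, ring_char_0} tensor_rat)"
  by (simp_all add: log_series_def tensor_frac_1)


section \<open>The \<open>p\<close>-sequence\<close>

definition digit_length :: "nat \<Rightarrow> nat \<Rightarrow> nat" where
  "digit_length p n = (LEAST s. s \<ge> 1 \<and> n < p ^ s)"

definition digit_concat :: "nat \<Rightarrow> nat \<Rightarrow> nat \<Rightarrow> nat" where
  "digit_concat p n m = n + m * p ^ digit_length p n"

text \<open>
  Tuples are nonempty lists. Since \<open>n * 0 = n\<close>, the fold with start value \<open>0\<close> is
  \<open>n_1 * (n_2 * (\<dots> * n_k))\<close>; by \<open>digit_concat_assoc\<close> the bracketing is irrelevant.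
\<close>

definition concat_tuples :: "nat \<Rightarrow> nat \<Rightarrow> nat list set" where
  "concat_tuples p n = {ns. ns \<noteq> [] \<and> (\<forall>m\<in>set (tl ns). m > 0) \<and> foldr (digit_concat p) ns 0 = n}"

definition p_sequence :: "nat \<Rightarrow> ('a \<Rightarrow> 'a) \<Rightarrow> (nat \<Rightarrow> 'a::comm_ring_1) \<Rightarrow> nat \<Rightarrow> 'a" where
  "p_sequence p \<sigma> b n = (\<Sum>ns\<in>concat_tuples p n. (- 1) ^ (length ns - 1) *
     (\<Prod>i<length ns. (\<sigma> ^^ (\<Sum>j<i. digit_length p (ns ! j))) (b (ns ! i))))"

definition frobenius_lift :: "nat \<Rightarrow> ('a::comm_ring_1 \<Rightarrow> 'a) \<Rightarrow> bool" where
  "frobenius_lift p \<sigma> \<longleftrightarrow> \<sigma> 1 = 1 \<and> (\<forall>r s. \<sigma> (r + s) = \<sigma> r + \<sigma> s) \<and>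
     (\<forall>r s. \<sigma> (r * s) = \<sigma> r * \<sigma> s) \<and> (\<forall>r. of_nat p dvd \<sigma> r - r ^ p)"

lemma digit_length_props:
  assumes "p > 1"
  shows "digit_length p n \<ge> 1" and "n < p ^ digit_length p n"
    and "s \<ge> 1 \<Longrightarrow> n < p ^ s \<Longrightarrow> digit_length p n \<le> s"
proof -
  have "Suc n \<ge> 1 \<and> n < p ^ Suc n"
    using less_exp[of "Suc n"] power_mono[of 2 p "Suc n"] assms by linarith
  from LeastI[of "\<lambda>s. s \<ge> 1 \<and> n < p ^ s", OF this]
  show "digit_length p n \<ge> 1" and "n < p ^ digit_length p n"
    by (simp_all add: digit_length_def)
  show "s \<ge> 1 \<Longrightarrow> n < p ^ s \<Longrightarrow> digit_length p n \<le> s"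
    unfolding digit_length_def by (rule Least_le) simp
qed

lemma digit_length_concat:
  assumes "p > 1" and "m > 0"
  shows "digit_length p (digit_concat p n m) = digit_length p n + digit_length p m"
proof -
  let ?l = "digit_length p n" and ?k = "digit_length p m"
  let ?N = "digit_concat p n m"
  note n = digit_length_props(1,2)[OF assms(1), of n] and m = digit_length_props(1,2)[OF assms(1), of m]
  have "?N < p ^ (?l + ?k)"
  proof -
    have "?N < (m + 1) * p ^ ?l"
      using n(2) by (simp add: digit_concat_def)
    also have "\<dots> \<le> p ^ ?k * p ^ ?l"
      using m(2) by (intro mult_right_mono) auto
    finally show ?thesis by (simp add: power_add mult.commute)
  qed
  then have le: "digit_length p ?N \<le> ?l + ?k"
    using n(1) by (intro digit_length_props(3)[OF assms(1)]) auto
  have lower: "p ^ (?k - 1) \<le> m"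
  proof (cases "?k = 1")
    case False
    then show ?thesis using m(1) digit_length_props(3)[OF assms(1), of "?k - 1" m] by (force simp: not_less)
  qed (use assms(2) in auto)
  have "p ^ (?l + ?k - 1) = p ^ ?l * p ^ (?k - 1)"
    using m(1) by (simp flip: power_add)
  also have "\<dots> \<le> ?N"
    using lower by (simp add: digit_concat_def trans_le_add2)
  also have "\<dots> < p ^ digit_length p ?N"
    by (rule digit_length_props(2)[OF assms(1)])
  finally have "?l + ?k - 1 < digit_length p ?N"
    using assms(1) power_less_imp_less_exp by blast
  with le show ?thesis by simp
qed

lemma digit_concat_assoc:
  assumes "p > 1" and "m > 0"
  shows "digit_concat p (digit_concat p n m) l = digit_concat p n (digit_concat p m l)"
  by (simp add: digit_concat_def[of p "digit_concat p n m"] digit_length_concat[OF assms])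
     (simp add: digit_concat_def algebra_simps power_add)

lemma finite_concat_tuples:
  assumes "p > 1"
  shows "finite (concat_tuples p n)"
proof (rule finite_subset)
  have sum: "sum_list ns \<le> foldr (digit_concat p) ns 0" for ns
  proof (induction ns)
    case (Cons m ns)
    have "sum_list ns * 1 \<le> foldr (digit_concat p) ns 0 * p ^ digit_length p m"
      using Cons.IH assms by (intro mult_le_mono) auto
    then show ?case by (simp add: digit_concat_def[of p m])
  qed simp
  have len: "length ns \<le> sum_list ns" if "\<forall>m\<in>set ns. m > 0" for ns :: "nat list"
    using that by (induction ns) auto
  show "concat_tuples p n \<subseteq> {ns. set ns \<subseteq> {..n} \<and> length ns \<le> Suc n}"
  proof
    fix ns assume ns: "ns \<in> concat_tuples p n"
    then have "sum_list ns \<le> n" using sum[of ns] by (simp add: concat_tuples_def)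
    then have "set ns \<subseteq> {..n}" using member_le_sum_list by fastforce
    moreover have "length ns \<le> Suc n"
      using ns len[of "tl ns"] \<open>sum_list ns \<le> n\<close> by (cases ns) (auto simp: concat_tuples_def)
    ultimately show "ns \<in> {ns. set ns \<subseteq> {..n} \<and> length ns \<le> Suc n}" by simp
  qed
  show "finite {ns. set ns \<subseteq> {..n} \<and> length ns \<le> Suc n}"
    by (rule finite_lists_length_le) simp
qed

end

theory Submission
  imports Defs
begin

text \<open>
  Fix a prime \<open>p\<close> and let \<open>O\<close> be the localisation of \<open>R\<close> at \<open>p\<close> inside \<open>R \<otimes> \<rat>\<close>. Let
  \<open>\<Phi>\<close> denote the lift of Frobenius on power series that applies \<open>\<sigma>\<close> to coefficients and raises
  the variables to the power \<open>p\<close>. The law \<open>F\<close> has coefficients in \<open>O\<close> iff its logarithm satisfies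
  \<open>p f \<equiv> \<Sum>\<^sub>i w\<^sub>i \<Phi>\<^sup>i f\<close> modulo \<open>p O[[x]]\<close> for some \<open>w\<^sub>i \<in> O\<close>.

  Sufficiency is Hazewinkel's functional equation lemma: the equation for \<open>f\<close> and for
  \<open>f(x) + f(y) = f(F)\<close> determines \<open>F\<close> degree by degree, because integral \<open>\<alpha> \<equiv> \<beta>\<close> mod \<open>p\<close> satisfy
  \<open>\<alpha>\<^sup>n \<equiv> \<beta>\<^sup>n\<close> mod \<open>p n\<close> up to units.

  For necessity (following Honda), call \<open>h\<close> a quasi-logarithm of \<open>F\<close> if \<open>h'\<close> is integral and
  \<open>h(F(x, y)) \<equiv> h(x) + h(y)\<close> mod \<open>p\<close>. If \<open>h'(0) = 0\<close>, differentiating in \<open>y\<close> at \<open>y = 0\<close> gives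
  \<open>h' \<equiv> 0\<close> mod \<open>p\<close>, so \<open>h \<equiv> k(x\<^sup>p)\<close>, and \<open>k\<close> is a quasi-logarithm of \<open>F\<^sup>\<sigma>\<close>, whose logarithm is
  \<open>f\<^sup>\<sigma>\<close>. Starting from \<open>h = p f\<close> and subtracting the linear term of \<open>k\<close> times \<open>f\<^sup>\<sigma>\<close> at each
  step produces the \<open>w\<^sub>i\<close>; they satisfy the equation exactly at the exponents \<open>p\<^sup>k\<close>.

  On the other side, the recursion for the \<open>p\<close>-sequence says that \<open>c\<^sub>n\<close> with \<open>n = p\<^sup>i - 1\<close> equals
  \<open>p\<^sup>i\<^sup>-\<^sup>1 w\<^sub>i\<close> for this solution, and that the divisibility of \<open>c\<^sub>n\<close> for \<open>n = m p\<^sup>k - 1\<close>, \<open>m > 1\<close>,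
  is equivalent to the coefficient of \<open>x\<^sup>n\<^sup>+\<^sup>1\<close> in the functional equation. Finally \<open>R\<close> is the
  intersection of its localisations.
\<close>

section \<open>Semilinear operations on power series\<close>

locale unital_hom =
  fixes \<phi> :: "'a::comm_ring_1 \<Rightarrow> 'b::comm_ring_1"
  assumes hom_one: "\<phi> 1 = 1"
    and hom_add: "\<phi> (x + y) = \<phi> x + \<phi> y"
    and hom_mult: "\<phi> (x * y) = \<phi> x * \<phi> y"
begin

lemma hom_zero: "\<phi> 0 = 0"
  using hom_add[of 0 0] by simp

lemma hom_uminus: "\<phi> (- x) = - \<phi> x"
  using hom_add[of x "- x"] by (simp add: hom_zero eq_neg_iff_add_eq_0 add.commute)

lemma hom_diff: "\<phi> (x - y) = \<phi> x - \<phi> y"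
  using hom_add[of x "- y"] by (simp add: hom_uminus)

lemma hom_sum: "\<phi> (sum g A) = (\<Sum>i\<in>A. \<phi> (g i))"
  by (induction A rule: infinite_finite_induct) (simp_all add: hom_zero hom_add)

lemma hom_power: "\<phi> (x ^ n) = \<phi> x ^ n"
  by (induction n) (simp_all add: hom_one hom_mult)

lemma hom_of_nat: "\<phi> (of_nat n) = of_nat n"
  by (induction n) (simp_all add: hom_zero hom_one hom_add)

lemmas hom_simps = hom_zero hom_one hom_add hom_mult hom_uminus hom_diff hom_sum hom_power hom_of_nat

end

lemma unital_hom_id: "unital_hom (\<lambda>x. x)"
  by unfold_locales simp_all

lemma unital_hom_funpow: "unital_hom (\<phi> :: 'a::comm_ring_1 \<Rightarrow> 'a) \<Longrightarrow> unital_hom (\<phi> ^^ n)"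
  by (induction n) (simp_all add: unital_hom_def)

lemma unital_hom_fps_const: "unital_hom (fps_const :: 'a::comm_ring_1 \<Rightarrow> _)"
  by unfold_locales simp_all

lemma unital_hom_fps_nth_0: "unital_hom (\<lambda>A :: 'a::comm_ring_1 fps. A $ 0)"
  by unfold_locales simp_all

section \<open>Coefficient maps and twists by a power of the variable\<close>

definition fps_map :: "('a::comm_ring_1 \<Rightarrow> 'b::comm_ring_1) \<Rightarrow> 'a fps \<Rightarrow> 'b fps" where
  "fps_map \<phi> A = Abs_fps (\<lambda>n. \<phi> (A $ n))"

text \<open>With a Frobenius lift for \<open>\<phi>\<close> and \<open>q = p\<close> this is the
  operator \<Phi> of the overview. With the identity for \<open>\<phi>\<close> it is the plain
  substitution of x^q for x, which later separates the two effects of \<Phi>.\<close>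

definition fps_twist :: "nat \<Rightarrow> ('a::comm_ring_1 \<Rightarrow> 'b::comm_ring_1) \<Rightarrow> 'a fps \<Rightarrow> 'b fps" where
  "fps_twist q \<phi> A = Abs_fps (\<lambda>n. if q dvd n then \<phi> (A $ (n div q)) else 0)"

lemma fps_map_nth [simp]: "fps_map \<phi> A $ n = \<phi> (A $ n)"
  by (simp add: fps_map_def)

lemma fps_twist_nth: "fps_twist q \<phi> A $ n = (if q dvd n then \<phi> (A $ (n div q)) else 0)"
  by (simp add: fps_twist_def)

lemma fps_compose_X_power_nth:
  assumes "q > 0"
  shows "((A :: 'a::comm_ring_1 fps) oo fps_X ^ q) $ n = (if q dvd n then A $ (n div q) else 0)"
proof -
  have "(A oo fps_X ^ q) $ n = (\<Sum>i\<in>{0..n}. if n = q * i then A $ i else 0)"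
    unfolding fps_compose_nth
    by (intro sum.cong) (auto simp flip: power_mult simp: fps_X_power_nth)
  also have "\<dots> = (\<Sum>i\<in>{i. n = q * i}. A $ i)"
    using assms by (intro sum.mono_neutral_cong_right) auto
  also have "{i. n = q * i} = (if q dvd n then {n div q} else {})"
    using assms by auto
  finally show ?thesis by simp
qed

lemma fps_twist_eq_compose: "q > 0 \<Longrightarrow> fps_twist q \<phi> A = fps_map \<phi> A oo fps_X ^ q"
  by (simp add: fps_eq_iff fps_twist_nth fps_compose_X_power_nth)

lemma fps_power_compose:
  fixes c :: "'a::comm_ring_1 fps"
  assumes "c $ 0 = 0"
  shows "(a ^ n) oo c = (a oo c) ^ n"
  by (induction n) (simp_all add: fps_compose_mult_comm_ring[OF assms])

lemma (in unital_hom) unital_hom_fps_map: "unital_hom (fps_map \<phi>)"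
  by unfold_locales (simp_all add: fps_eq_iff fps_mult_nth hom_simps)

lemma (in unital_hom) unital_hom_fps_twist:
  assumes "q > 0"
  shows "unital_hom (fps_twist q \<phi>)"
proof -
  interpret m: unital_hom "fps_map \<phi>" by (rule unital_hom_fps_map)
  have "(fps_X ^ q :: 'b fps) $ 0 = 0" using assms by simp
  then show ?thesis
    by unfold_locales
      (simp_all add: fps_twist_eq_compose[OF assms] m.hom_simps fps_compose_add_distrib fps_compose_mult_comm_ring)
qed

lemma (in unital_hom) fps_map_compose: "fps_map \<phi> (A oo C) = fps_map \<phi> A oo fps_map \<phi> C"
proof -
  interpret m: unital_hom "fps_map \<phi>" by (rule unital_hom_fps_map)
  have "\<phi> ((C ^ i) $ n) = (fps_map \<phi> C ^ i) $ n" for i n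
    by (simp flip: m.hom_power)
  then show ?thesis
    by (simp add: fps_eq_iff fps_compose_nth hom_simps)
qed

lemma (in unital_hom) fps_twist_compose:
  assumes "q > 0" "C $ 0 = 0"
  shows "fps_twist q \<phi> (A oo C) = fps_map \<phi> A oo fps_twist q \<phi> C"
proof -
  have 0: "(fps_X ^ q :: 'b fps) $ 0 = 0" using assms by simp
  show ?thesis
    using assms
    by (simp add: fps_twist_eq_compose fps_map_compose fps_compose_assoc_comm_ring[OF 0] hom_zero)
qed

text \<open>Counterpart of \<open>fps_twist_compose\<close>: both right-hand sides have the outer
  series \<open>fps_map \<phi> A\<close>, while the inner series is the twist of C there and
  \<open>C ^ q\<close> here. The Frobenius congruence compares these two inner series.\<close>

lemma (in unital_hom) fps_twist_compose_right:
  fixes C :: "'b fps"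
  assumes "q > 0" "C $ 0 = 0"
  shows "fps_twist q \<phi> A oo C = fps_map \<phi> A oo C ^ q"
proof -
  have "fps_X ^ q oo C = C ^ q"
    using assms by (simp add: fps_power_compose)
  moreover have 0: "(fps_X ^ q :: 'b fps) $ 0 = 0" using assms by simp
  ultimately show ?thesis
    by (simp add: fps_twist_eq_compose assms fps_compose_assoc_comm_ring[OF assms(2) 0, symmetric])
qed

lemma fps_twist_twist:
  assumes "q > 0" "r > 0" "\<phi> 0 = 0"
  shows "fps_twist q \<phi> (fps_twist r \<psi> A) = fps_twist (r * q) (\<lambda>x. \<phi> (\<psi> x)) A"
proof (rule fps_ext)
  fix n
  show "fps_twist q \<phi> (fps_twist r \<psi> A) $ n = fps_twist (r * q) (\<lambda>x. \<phi> (\<psi> x)) A $ n"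
  proof (cases "q dvd n")
    case True
    then obtain k where n: "n = q * k" by blast
    have "r * q dvd q * k \<longleftrightarrow> r dvd k" "q * k div (r * q) = k div r"
      using assms by (simp_all add: mult.commute[of r])
    then show ?thesis
      using assms by (simp add: n fps_twist_nth)
  next
    case False
    then have "\<not> r * q dvd n" using dvd_mult_right by blast
    with False show ?thesis by (simp add: fps_twist_nth)
  qed
qed

lemma fps_twist_funpow:
  fixes \<phi> :: "'a::comm_ring_1 \<Rightarrow> 'a"
  assumes "q > 0" "\<phi> 0 = 0"
  shows "(fps_twist q \<phi> ^^ i) A = fps_twist (q ^ i) (\<phi> ^^ i) A"
proof (induction i)
  case 0
  show ?case by (simp add: fps_eq_iff fps_twist_nth)
next
  case (Suc i)
  have "fps_twist q \<phi> (fps_twist (q ^ i) (\<phi> ^^ i) A) = fps_twist (q ^ i * q) (\<lambda>x. \<phi> ((\<phi> ^^ i) x)) A"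
    using assms by (intro fps_twist_twist) simp_all
  also have "\<dots> = fps_twist (q ^ Suc i) (\<phi> ^^ Suc i) A"
    by (simp add: comp_def mult.commute)
  finally show ?case by (simp add: Suc comp_def)
qed

text \<open>Factor A^k - B^k as (A - B) times a sum of mixed products. The first factor starts in
  degree N or later, and for k \<ge> 2 the second has no constant term. This is what makes recursion
  on the degree possible.\<close>

lemma fps_power_cong_below:
  fixes A B :: "'a::comm_ring_1 fps"
  assumes AB: "\<And>m. m < N \<Longrightarrow> A $ m = B $ m" and 0: "A $ 0 = 0" "B $ 0 = 0" and "k \<ge> 2"
  shows "(A ^ k) $ N = (B ^ k) $ N"
proof -
  let ?S = "\<Sum>i<k. B ^ (k - Suc i) * A ^ i"
  have "(B ^ (k - Suc i) * A ^ i) $ 0 = 0" if "i < k" for i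
    using that 0 \<open>k \<ge> 2\<close> by (cases "i = 0") (auto simp: fps_nth_power_0 power_0_left)
  then have S: "?S $ 0 = 0" by (simp add: fps_sum_nth)
  have "(A - B) $ i * ?S $ (N - i) = 0" if "i \<le> N" for i
    using AB[of i] S that by (cases "i = N") auto
  then have "((A - B) * ?S) $ N = 0"
    unfolding fps_mult_nth by (intro sum.neutral) simp
  then show ?thesis
    by (simp flip: power_diff_sumr2)
qed

section \<open>Integral elements and Frobenius lifts\<close>

text \<open>Divisibility has to be relative to S: in the intended ambient ring
  \<open>R \<otimes> \<rat>\<close> every positive integer is a unit.\<close>

definition multiples :: "nat \<Rightarrow> 'a::comm_ring_1 set \<Rightarrow> 'a set" where
  "multiples d S = (\<lambda>r. of_nat d * r) ` S"

definition int_fps :: "'a::comm_ring_1 set \<Rightarrow> 'a fps set" where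
  "int_fps S = {A. \<forall>n. A $ n \<in> S}"

lemma multiplesI: "r \<in> S \<Longrightarrow> a = of_nat d * r \<Longrightarrow> a \<in> multiples d S"
  by (auto simp: multiples_def)

lemma multiplesE:
  assumes "a \<in> multiples d S"
  obtains r where "r \<in> S" "a = of_nat d * r"
  using assms by (auto simp: multiples_def)

lemma int_fpsD: "A \<in> int_fps S \<Longrightarrow> A $ n \<in> S"
  by (simp add: int_fps_def)

lemma multiples_int_fps_iff:
  "A \<in> multiples d (int_fps S) \<longleftrightarrow> (\<forall>n. A $ n \<in> multiples d S)"
proof
  assume "A \<in> multiples d (int_fps S)"
  then obtain R where "R \<in> int_fps S" "A = of_nat d * R" by (rule multiplesE)
  then show "\<forall>n. A $ n \<in> multiples d S"
    by (auto simp: fps_of_nat[symmetric] int_fps_def intro!: multiplesI)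
next
  assume "\<forall>n. A $ n \<in> multiples d S"
  then have "\<forall>n. \<exists>r. r \<in> S \<and> A $ n = of_nat d * r"
    by (metis multiplesE)
  then obtain r where "\<And>n. r n \<in> S \<and> A $ n = of_nat d * r n"
    by metis
  then show "A \<in> multiples d (int_fps S)"
    by (intro multiplesI[of "Abs_fps r"]) (simp_all add: int_fps_def fps_eq_iff fps_of_nat[symmetric])
qed

section \<open>Congruences relative to a subring\<close>

locale unital_subring =
  fixes S :: "'a::comm_ring_1 set"
  assumes one_in: "1 \<in> S"
    and add_in: "x \<in> S \<Longrightarrow> y \<in> S \<Longrightarrow> x + y \<in> S"
    and mult_in: "x \<in> S \<Longrightarrow> y \<in> S \<Longrightarrow> x * y \<in> S"
    and uminus_in: "x \<in> S \<Longrightarrow> - x \<in> S"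
begin

lemma zero_in: "0 \<in> S"
  using add_in[OF one_in uminus_in[OF one_in]] by simp

lemma diff_in: "x \<in> S \<Longrightarrow> y \<in> S \<Longrightarrow> x - y \<in> S"
  using add_in[of x "- y"] uminus_in by simp

lemma sum_in: "(\<And>i. i \<in> A \<Longrightarrow> g i \<in> S) \<Longrightarrow> sum g A \<in> S"
  by (induction A rule: infinite_finite_induct) (auto simp: zero_in add_in)

lemma power_in: "x \<in> S \<Longrightarrow> x ^ n \<in> S"
  by (induction n) (auto simp: one_in mult_in)

lemma of_nat_in: "of_nat n \<in> S"
  by (induction n) (auto simp: zero_in one_in add_in)

lemma multiples_zero: "0 \<in> multiples d S"
  by (rule multiplesI[of 0]) (simp_all add: zero_in)

lemma multiples_add: "x \<in> multiples d S \<Longrightarrow> y \<in> multiples d S \<Longrightarrow> x + y \<in> multiples d S"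
proof (elim multiplesE)
  fix r s assume "r \<in> S" "s \<in> S" "x = of_nat d * r" "y = of_nat d * s"
  then show ?thesis
    by (intro multiplesI[of "r + s"] add_in) (simp_all add: algebra_simps)
qed

lemma multiples_uminus: "x \<in> multiples d S \<Longrightarrow> - x \<in> multiples d S"
  by (auto elim!: multiplesE intro!: multiplesI[OF uminus_in])

lemma multiples_diff: "x \<in> multiples d S \<Longrightarrow> y \<in> multiples d S \<Longrightarrow> x - y \<in> multiples d S"
  using multiples_add[of x d "- y"] multiples_uminus by simp

lemma multiples_sum: "(\<And>i. i \<in> A \<Longrightarrow> g i \<in> multiples d S) \<Longrightarrow> sum g A \<in> multiples d S"
  by (induction A rule: infinite_finite_induct) (auto simp: multiples_zero multiples_add)

lemma multiples_mult_mult: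
  "x \<in> multiples d S \<Longrightarrow> y \<in> multiples e S \<Longrightarrow> x * y \<in> multiples (d * e) S"
proof (elim multiplesE)
  fix r s assume "r \<in> S" "s \<in> S" "x = of_nat d * r" "y = of_nat e * s"
  then show ?thesis
    by (intro multiplesI[of "r * s"] mult_in) (simp_all add: algebra_simps)
qed

lemma multiples_of_nat_mult:
  "x \<in> multiples e S \<Longrightarrow> of_nat d * x \<in> multiples (d * e) S"
  by (rule multiples_mult_mult[OF multiplesI[OF one_in]]) simp_all

lemma multiples_mult: "x \<in> multiples d S \<Longrightarrow> y \<in> S \<Longrightarrow> x * y \<in> multiples d S"
  using multiples_mult_mult[of x d y 1] by (simp add: multiples_def)

lemma multiples_mult': "y \<in> S \<Longrightarrow> x \<in> multiples d S \<Longrightarrow> y * x \<in> multiples d S"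
  using multiples_mult[of x d y] by (simp add: mult.commute)

lemma multiples_dvd: "x \<in> multiples d S \<Longrightarrow> e dvd d \<Longrightarrow> x \<in> multiples e S"
proof (elim multiplesE dvdE)
  fix r k assume "r \<in> S" "x = of_nat d * r" "d = e * k"
  then show ?thesis
    by (intro multiplesI[of "of_nat k * r"] mult_in of_nat_in) (simp_all add: algebra_simps)
qed

lemma multiples_subset: "x \<in> multiples d S \<Longrightarrow> x \<in> S"
  by (elim multiplesE) (auto simp: mult_in of_nat_in)

lemma unital_subring_int_fps: "unital_subring (int_fps S)"
proof
  show "1 \<in> int_fps S"
    by (simp add: int_fps_def one_in zero_in)
  show "x * y \<in> int_fps S" if "x \<in> int_fps S" "y \<in> int_fps S" for x y
    using that unfolding int_fps_def fps_mult_nth mem_Collect_eq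
    by (auto intro!: sum_in mult_in)
qed (simp_all add: int_fps_def add_in uminus_in)

lemma fps_const_int: "c \<in> S \<Longrightarrow> fps_const c \<in> int_fps S"
  by (simp add: int_fps_def zero_in)

lemma fps_X_int: "fps_X \<in> int_fps S"
  by (simp add: int_fps_def zero_in one_in)

lemma compose_int:
  assumes "A \<in> int_fps S" "C \<in> int_fps S"
  shows "A oo C \<in> int_fps S"
proof -
  interpret F: unital_subring "int_fps S" by (rule unital_subring_int_fps)
  show ?thesis
    using assms(1) F.power_in[OF assms(2)]
    by (auto simp: int_fps_def fps_compose_nth intro!: sum_in mult_in)
qed

end

text \<open>S abstracts the localisation O inside a torsion-free ambient ring. The abstraction is
  used at three levels: O itself, O[[s]] and O[[s]][[t]].\<close>

locale frob_ring = unital_subring S + unital_hom \<phi>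
  for S :: "'a::comm_ring_1 set" and \<phi> :: "'a \<Rightarrow> 'a" +
  fixes p :: nat
  assumes prime: "prime p"
    and frob: "x \<in> S \<Longrightarrow> \<phi> x - x ^ p \<in> multiples p S"
    and torsion_free: "n > 0 \<Longrightarrow> of_nat n * x = 0 \<Longrightarrow> x = 0"
    and coprime_divide: "coprime n p \<Longrightarrow> of_nat n * x \<in> S \<Longrightarrow> x \<in> S"
begin

section \<open>Congruences modulo powers of p in the presence of a Frobenius lift\<close>

lemma p_pos: "p > 0" and p_gt_1: "p > 1"
  using prime_gt_0_nat[OF prime] prime_gt_1_nat[OF prime] by simp_all

lemma cancel: "n > 0 \<Longrightarrow> of_nat n * x = of_nat n * y \<Longrightarrow> x = y" for x y :: 'a
  using torsion_free[of n "x - y"] by (simp add: algebra_simps)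

lemma hom_in:
  assumes "x \<in> S"
  shows "\<phi> x \<in> S"
  using add_in[OF multiples_subset[OF frob[OF assms]] power_in[OF assms, of p]] by simp

lemma hom_multiples: "x \<in> multiples d S \<Longrightarrow> \<phi> x \<in> multiples d S"
  by (auto elim!: multiplesE simp: hom_simps intro!: multiplesI[OF hom_in])

lemma multiples_cancel:
  assumes "n > 0" "of_nat n * x \<in> multiples (n * d) S"
  shows "x \<in> multiples d S"
proof -
  obtain r where r: "r \<in> S" "of_nat n * x = of_nat (n * d) * r"
    using assms(2) by (rule multiplesE)
  then have "x = of_nat d * r"
    using cancel[OF assms(1), of x "of_nat d * r"] by (simp add: mult.assoc)
  with r(1) show ?thesis by (rule multiplesI)
qed

text \<open>Only n x, not x, is known to lie in S. Bezout for n and p^k writes x as p^k y; then n y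
  is the given quotient r, so y lies in S by \<open>coprime_divide\<close>.\<close>

lemma multiples_coprime:
  assumes "coprime n p" "of_nat n * x \<in> multiples (p ^ k) S"
  shows "x \<in> multiples (p ^ k) S"
proof -
  obtain r where r: "r \<in> S" "of_nat n * x = of_nat (p ^ k) * r"
    using assms(2) by (rule multiplesE)
  obtain u v where uv: "u * int n + v * int (p ^ k) = 1"
    using assms(1) bezout_int[of "int n" "int (p ^ k)"] 
    by (metis coprime_imp_gcd_eq_1 coprime_int_iff coprime_power_right_iff)
  let ?y = "of_int u * r + of_int v * x"
  have "x = of_int (u * int n + v * int (p ^ k)) * x"
    using uv by simp
  also have "\<dots> = of_int u * (of_nat n * x) + of_nat (p ^ k) * (of_int v * x)"
    by (simp add: algebra_simps)
  also have "\<dots> = of_nat (p ^ k) * ?y"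
    unfolding r(2) by (simp add: algebra_simps)
  finally have x: "x = of_nat (p ^ k) * ?y" .
  have "of_nat (p ^ k) * (of_nat n * ?y) = of_nat (p ^ k) * r"
    using x r(2) by (metis mult.left_commute)
  then have "of_nat n * ?y = r"
    using p_pos cancel[of "p ^ k" "of_nat n * ?y" r] by simp
  then have "?y \<in> S"
    using r(1) coprime_divide[OF assms(1), of ?y] by simp
  with x show ?thesis by (rule multiplesI[rotated])
qed

text \<open>In x^p - y^p = (x - y) * (sum of p products), each product is congruent to y^(p-1) mod
  p, so the sum is divisible by p and supplies the extra factor.\<close>

lemma multiples_power_step:
  assumes "x \<in> S" "y \<in> S" "x - y \<in> multiples (p ^ k) S" "k \<ge> 1"
  shows "x ^ p - y ^ p \<in> multiples (p ^ Suc k) S"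
proof -
  have xy: "x - y \<in> multiples p S"
    using assms(3,4) by (auto intro: multiples_dvd)
  have pow: "x ^ i - y ^ i \<in> multiples p S" for i
    unfolding power_diff_sumr2 using assms(1,2)
    by (intro multiples_mult[OF xy] sum_in mult_in power_in)
  have "(\<Sum>i<p. y ^ (p - Suc i) * (x ^ i - y ^ i)) \<in> multiples p S"
    using assms(2) by (intro multiples_sum multiples_mult' pow power_in)
  moreover have "of_nat p * y ^ (p - 1) \<in> multiples p S"
    using assms(2) by (intro multiplesI[OF _ refl] power_in)
  ultimately have "(\<Sum>i<p. y ^ (p - Suc i) * (x ^ i - y ^ i)) + of_nat p * y ^ (p - 1) \<in> multiples p S"
    by (rule multiples_add)
  also have "of_nat p * y ^ (p - 1) = (\<Sum>i<p. y ^ (p - Suc i) * y ^ i)"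
    by (simp flip: power_add)
  finally have "(\<Sum>i<p. y ^ (p - Suc i) * x ^ i) \<in> multiples p S"
    by (simp add: algebra_simps sum_subtractf)
  from multiples_mult_mult[OF assms(3) this] show ?thesis
    by (simp add: power_diff_sumr2 mult.commute)
qed

lemma multiples_power:
  assumes "x \<in> S" "y \<in> S" "x - y \<in> multiples p S" "p ^ v dvd n"
  shows "x ^ n - y ^ n \<in> multiples (p ^ Suc v) S"
proof -
  have *: "x ^ (p ^ v) - y ^ (p ^ v) \<in> multiples (p ^ Suc v) S"
  proof (induction v)
    case 0
    show ?case using assms(3) by simp
  next
    case (Suc v)
    show ?case
      using multiples_power_step[OF power_in[OF assms(1)] power_in[OF assms(2)] Suc]
      by (simp flip: power_mult add: mult.commute)
  qed
  obtain m where "n = p ^ v * m" using assms(4) by blast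
  then have "x ^ n - y ^ n = (x ^ (p ^ v)) ^ m - (y ^ (p ^ v)) ^ m"
    by (simp add: power_mult)
  also have "\<dots> \<in> multiples (p ^ Suc v) S"
    unfolding power_diff_sumr2[of _ m] using assms(1,2)
    by (intro multiples_mult[OF *] sum_in mult_in power_in)
  finally show ?thesis .
qed

text \<open>A denominator \<open>n\<close> is compensated by the gain of \<open>v\<^sub>p(n)\<close> in passing to \<open>n\<close>-th powers.\<close>

lemma multiples_frac_power:
  assumes "x \<in> S" "y \<in> S" "x - y \<in> multiples p S" and c: "of_nat n * c \<in> S"
  shows "c * (x ^ n - y ^ n) \<in> multiples p S"
proof (cases "n = 0")
  case True
  then show ?thesis by (simp add: multiples_zero)
next
  case False
  obtain v m where nm: "n = p ^ v * m" "coprime m p"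
    using multiplicity_decompose'[of n p] False prime prime_imp_coprime[of p]
    by (metis coprime_commute not_prime_unit)
  have "of_nat m * (of_nat (p ^ v) * c) \<in> S"
    using c by (simp add: nm(1) algebra_simps)
  then have "of_nat (p ^ v) * c \<in> S"
    by (rule coprime_divide[OF nm(2)])
  moreover obtain r where "r \<in> S" "x ^ n - y ^ n = of_nat (p ^ Suc v) * r"
    using multiples_power[OF assms(1-3), of v n] nm(1) by (auto elim: multiplesE)
  ultimately show ?thesis
    by (intro multiplesI[of "of_nat (p ^ v) * c * r"] mult_in[of "of_nat (p ^ v) * c"])
      (simp_all add: algebra_simps)
qed

lemma frob_funpow:
  assumes "x \<in> S"
  shows "(\<phi> ^^ i) x \<in> S" and "(\<phi> ^^ i) x - x ^ (p ^ i) \<in> multiples p S"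
proof -
  show in_S: "(\<phi> ^^ i) x \<in> S" for i
    using assms by (induction i) (simp_all add: hom_in)
  show "(\<phi> ^^ i) x - x ^ (p ^ i) \<in> multiples p S"
  proof (induction i)
    case 0
    show ?case by (simp add: multiples_zero)
  next
    case (Suc i)
    have "\<phi> ((\<phi> ^^ i) x) - \<phi> (x ^ (p ^ i)) \<in> multiples p S"
      using hom_multiples[OF Suc] by (simp add: hom_diff)
    moreover have "\<phi> (x ^ (p ^ i)) - (x ^ (p ^ i)) ^ p \<in> multiples p S"
      by (intro frob power_in assms)
    ultimately show ?case
      using multiples_add by (fastforce simp flip: power_mult simp: mult.commute)
  qed
qed

text \<open>Write x = a + X y. Modulo p the p-th power is additive, so the error of x is the error
  of a plus X^p times the error of y. The coefficient index drops by p, which gives an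
  induction.\<close>

lemma frob_ring_int_fps: "frob_ring (int_fps S) (fps_twist p \<phi>) p"
proof -
  interpret F: unital_subring "int_fps S" by (rule unital_subring_int_fps)
  interpret T: unital_hom "fps_twist p \<phi>" by (rule unital_hom_fps_twist[OF p_pos])
  have binom: "(x + y) ^ p - (x ^ p + y ^ p) \<in> multiples p (int_fps S)"
    if "x \<in> int_fps S" "y \<in> int_fps S" for x y
  proof -
    have "(x + y) ^ p = (\<Sum>k\<in>insert 0 (insert p {0<..<p}). of_nat (p choose k) * x ^ k * y ^ (p - k))"
      unfolding binomial_ring by (rule sum.cong) auto
    also have "\<dots> = x ^ p + y ^ p + (\<Sum>k\<in>{0<..<p}. of_nat (p choose k) * x ^ k * y ^ (p - k))"
      using p_pos by simp
    finally have "(x + y) ^ p - (x ^ p + y ^ p) =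
        (\<Sum>k\<in>{0<..<p}. of_nat (p choose k) * x ^ k * y ^ (p - k))"
      by simp
    also have "\<dots> \<in> multiples p (int_fps S)"
    proof (rule F.multiples_sum)
      fix k assume "k \<in> {0<..<p}"
      then obtain c where c: "p choose k = p * c"
        using dvd_choose_prime[of k p] prime by auto
      show "of_nat (p choose k) * x ^ k * y ^ (p - k) \<in> multiples p (int_fps S)"
        unfolding c using that
        by (intro multiplesI[of "of_nat c * x ^ k * y ^ (p - k)"] F.mult_in F.power_in F.of_nat_in)
          (simp_all add: algebra_simps)
    qed
    finally show ?thesis .
  qed
  have frob_nth: "(fps_twist p \<phi> x - x ^ p) $ n \<in> multiples p S" if "x \<in> int_fps S" for x n
    using that
  proof (induction n arbitrary: x rule: less_induct)
    case (less n)
    define a y where "a = x $ 0" and "y = fps_shift 1 x"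
    have x: "x = fps_const a + fps_X * y"
      unfolding a_def y_def by (rule fps_ext) (auto simp: fps_X_mult_nth)
    have a: "a \<in> S" and y: "y \<in> int_fps S"
      using less.prems by (auto simp: a_def y_def int_fps_def)
    have twX: "fps_twist p \<phi> fps_X = fps_X ^ p"
      using p_gt_1 by (auto simp: fps_eq_iff fps_twist_nth fps_X_power_nth hom_simps elim!: dvdE)
    have twc: "fps_twist p \<phi> (fps_const a) = fps_const (\<phi> a)"
      by (auto simp: fps_eq_iff fps_twist_nth hom_simps fps_const_def)
    define d where "d = x ^ p - (fps_const a ^ p + (fps_X * y) ^ p)"
    have "d \<in> multiples p (int_fps S)"
      unfolding d_def x using a y by (intro binom F.mult_in fps_X_int fps_const_int)
    then have d: "d $ n \<in> multiples p S"
      by (simp only: multiples_int_fps_iff)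
    have "fps_twist p \<phi> x - x ^ p = fps_const (\<phi> a - a ^ p)
        + fps_X ^ p * (fps_twist p \<phi> y - y ^ p) - d"
      by (subst (1) x) (simp add: d_def T.hom_simps twX twc power_mult_distrib algebra_simps
          fps_const_sub[symmetric] del: fps_const_sub fps_const_power flip: fps_const_power)
    also have "\<dots> $ n \<in> multiples p S"
      unfolding fps_sub_nth fps_add_nth fps_X_power_mult_nth
      using frob[OF a] less.IH[of "n - p" y] y p_pos
      by (intro multiples_diff[OF multiples_add d]) (auto simp: multiples_zero)
    finally show ?case .
  qed
  show ?thesis
  proof
    show "prime p" by (rule prime)
    show "fps_twist p \<phi> x - x ^ p \<in> multiples p (int_fps S)" if "x \<in> int_fps S" for x
      using frob_nth[OF that] by (simp only: multiples_int_fps_iff) simp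
    show "x = 0" if "n > 0" "of_nat n * x = 0" for n and x :: "'a fps"
    proof (rule fps_ext)
      fix k
      have "of_nat n * x $ k = (of_nat n * x) $ k" by (simp add: fps_of_nat[symmetric])
      then show "x $ k = 0 $ k" using that torsion_free[of n "x $ k"] by simp
    qed
    show "x \<in> int_fps S" if "coprime n p" "of_nat n * x \<in> int_fps S" for n and x :: "'a fps"
      using that coprime_divide[OF that(1)]
      by (auto simp: int_fps_def fps_of_nat[symmetric])
  qed
qed

end

section \<open>From functional equations to integrality\<close>

lemma fps_compose_cong_upto:
  fixes A B C :: "'a::comm_ring_1 fps"
  assumes "\<And>m. m \<le> N \<Longrightarrow> A $ m = B $ m"
  shows "(C oo A) $ N = (C oo B) $ N"
proof -
  have "(A ^ k) $ m = (B ^ k) $ m" if "m \<le> N" for k m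
    using that by (induction k arbitrary: m) (simp_all add: fps_mult_nth assms)
  then show ?thesis by (simp add: fps_compose_nth)
qed

lemma fps_const_mult_compose:
  "(fps_const c * A) oo C = fps_const c * (A oo C)" for c :: "'a::comm_ring_1"
  by (simp add: fps_eq_iff fps_compose_nth sum_distrib_left mult.assoc)

context frob_ring
begin

text \<open>Termwise, \<open>multiples_frac_power\<close> in the ring of power series absorbs the
  denominator n of the n-th coefficient of A.\<close>

lemma compose_frob_cong:
  assumes A: "\<And>n. of_nat n * A $ n \<in> S"
    and "\<alpha> \<in> int_fps S" "\<beta> \<in> int_fps S" "\<alpha> - \<beta> \<in> multiples p (int_fps S)"
  shows "(A oo \<alpha>) - (A oo \<beta>) \<in> multiples p (int_fps S)"
proof -
  interpret T: frob_ring "int_fps S" "fps_twist p \<phi>" p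
    by (rule frob_ring_int_fps)
  have "A $ n * (\<alpha> ^ n - \<beta> ^ n) $ N \<in> multiples p S" for n N
  proof -
    have "of_nat n * fps_const (A $ n) \<in> int_fps S"
      using fps_const_int[OF A[of n]] by (simp add: fps_of_nat[symmetric])
    from T.multiples_frac_power[OF assms(2-4) this]
    have "(fps_const (A $ n) * (\<alpha> ^ n - \<beta> ^ n)) $ N \<in> multiples p S"
      by (simp only: multiples_int_fps_iff)
    then show ?thesis by simp
  qed
  then show ?thesis
    unfolding multiples_int_fps_iff
    by (auto simp: fps_compose_nth simp flip: sum_subtractf right_diff_distrib intro!: multiples_sum)
qed

text \<open>The full sum over i is infinite. For series without constant term, the i-th twist has no
  coefficients up to N once i > N, because p^i > N; so truncating at N is exact in degrees n \<le>
  N.\<close>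

definition functional_eq :: "(nat \<Rightarrow> 'a) \<Rightarrow> 'a fps \<Rightarrow> bool" where
  "functional_eq w f \<longleftrightarrow> (\<forall>N. \<forall>n\<le>N.
     (of_nat p * f - (\<Sum>i=1..N. fps_const (w i) * (fps_twist p \<phi> ^^ i) f)) $ n \<in> multiples p S)"

text \<open>Substitute F into g = p f - (sum of w_i \<Phi>^i f) and compare with the same expression
  for u = f(F). The two differ by values of conjugates of f at \<Phi>^i F and at F^(p^i). In degree
  N these involve only lower coefficients of F, integral by induction, so the difference is
  divisible by p. What remains is p F_N.\<close>

lemma functional_eq_integral:
  assumes f: "f $ 0 = 0" "f $ 1 = 1" "\<And>n. of_nat n * f $ n \<in> S"
    and w: "\<And>i. w i \<in> S"
    and "functional_eq w f" "functional_eq w u"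
    and F: "F $ 0 = 0" "f oo F = u"
  shows "F \<in> int_fps S"
proof -
  interpret T: frob_ring "int_fps S" "fps_twist p \<phi>" p
    by (rule frob_ring_int_fps)
  have "F $ N \<in> S" for N
  proof (induction N rule: less_induct)
    case (less N)
    show ?case
    proof (cases "N = 0")
      case True
      then show ?thesis by (simp add: F zero_in)
    next
      case False
      \<comment> \<open>G is integral by the induction hypothesis and replaces F wherever only
        coefficients below N matter.\<close>
      define G where "G = fps_cutoff N F"
      have G: "G \<in> int_fps S" "G $ 0 = 0" "\<And>m. m < N \<Longrightarrow> F $ m = G $ m"
        using less by (simp_all add: G_def int_fps_def zero_in F)
      define P where "P i = fps_twist p \<phi> ^^ i" for i
      define fi where "fi i = fps_map (\<phi> ^^ i) f" for i
      have P: "P i A = fps_twist (p ^ i) (\<phi> ^^ i) A" for i A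
        unfolding P_def by (rule fps_twist_funpow[where \<phi> = \<phi>, OF p_pos hom_zero])
      have hom: "unital_hom (\<phi> ^^ i)" for i
        by (rule unital_hom_funpow) (rule unital_hom_axioms)
      define g where "g = of_nat p * f - (\<Sum>i=1..N. fps_const (w i) * P i f)"
      have g: "g $ n \<in> multiples p S" if "n \<le> N" for n
        using assms(5) that by (simp add: functional_eq_def g_def P_def)
      have u: "(of_nat p * u - (\<Sum>i=1..N. fps_const (w i) * P i u)) $ N \<in> multiples p S"
        using assms(6) by (simp add: functional_eq_def P_def)
      have fF: "P i f oo F = fi i oo F ^ (p ^ i)" for i
        unfolding P fi_def using p_pos F(1) by (intro unital_hom.fps_twist_compose_right hom) simp_all
      have Pu: "P i u = fi i oo P i F" for i
        unfolding P fi_def F(2)[symmetric] using p_pos F(1)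
        by (intro unital_hom.fps_twist_compose hom) simp_all
      have pf: "of_nat p * f oo F = of_nat p * u"
        by (simp add: fps_of_nat[symmetric] fps_const_mult_compose F(2))
      have "g oo F = (of_nat p * u - (\<Sum>i=1..N. fps_const (w i) * P i u))
          + (\<Sum>i=1..N. fps_const (w i) * ((fi i oo P i F) - (fi i oo F ^ (p ^ i))))"
        unfolding g_def
        by (simp add: fps_compose_sub_distrib fps_compose_sum_distrib fps_const_mult_compose fF Pu pf
            right_diff_distrib sum_subtractf)
      moreover have "((fi i oo P i F) - (fi i oo F ^ (p ^ i))) $ N \<in> multiples p S"
        if "i \<in> {1..N}" for i
      proof -
        \<comment> \<open>Used twice: division by p^i lowers the index strictly, and F^(p^i) is a
          power with exponent at least 2, so \<open>fps_power_cong_below\<close> applies.\<close>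
        have pi: "p ^ i \<ge> 2"
          using p_gt_1 that self_le_power[of p i] by auto
        have "(fi i oo P i F) $ N = (fi i oo P i G) $ N"
        proof (rule fps_compose_cong_upto)
          fix m assume "m \<le> N"
          have "m div p ^ i < N"
            using div_less_dividend[of "p ^ i" m] \<open>m \<le> N\<close> False pi
            by (metis One_nat_def Suc_1 Suc_le_lessD bot_nat_0.not_eq_extremum div_0 le_less_trans order_le_less)
          then show "P i F $ m = P i G $ m"
            by (simp add: P fps_twist_nth G(3))
        qed
        moreover have "(fi i oo F ^ (p ^ i)) $ N = (fi i oo G ^ (p ^ i)) $ N"
        proof -
          have "((F ^ (p ^ i)) ^ n) $ N = ((G ^ (p ^ i)) ^ n) $ N" for n
          proof (cases "n = 0")
            case False
            then have "p ^ i * n \<ge> 2" using pi mult_le_mono[of 2 "p ^ i" 1 n] by simp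
            then show ?thesis
              unfolding power_mult[symmetric] by (intro fps_power_cong_below G F)
          qed simp
          then show ?thesis by (simp add: fps_compose_nth)
        qed
        moreover have "((fi i oo P i G) - (fi i oo G ^ (p ^ i))) \<in> multiples p (int_fps S)"
        proof (rule compose_frob_cong)
          show "of_nat n * fi i $ n \<in> S" for n
            using frob_funpow(1)[OF f(3)[of n], of i] unital_hom.hom_mult[OF hom]
              unital_hom.hom_of_nat[OF hom]
            by (simp add: fi_def)
          show "P i G \<in> int_fps S" "P i G - G ^ p ^ i \<in> multiples p (int_fps S)"
            unfolding P_def by (rule T.frob_funpow[OF G(1)])+
          show "G ^ p ^ i \<in> int_fps S" by (rule T.power_in[OF G(1)])
        qed
        ultimately show ?thesis
          by (simp add: multiples_int_fps_iff)
      qed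
      ultimately have gF: "(g oo F) $ N \<in> multiples p S"
        unfolding \<open>g oo F = _\<close> fps_add_nth fps_sum_nth fps_mult_left_const_nth
        by (intro multiples_add u multiples_sum multiples_mult' w)
      \<comment> \<open>Isolates the linear term of g, the only one in which F_N itself occurs; the
        term of index 0 vanishes because N > 0.\<close>
      have "{0..N} = insert 0 (insert 1 {2..N})"
        using False by auto
      then have "(g oo F) $ N = g $ 1 * F $ N + (\<Sum>n\<in>{2..N}. g $ n * (F ^ n) $ N)"
        using False by (simp add: fps_compose_nth)
      moreover have "(\<Sum>n\<in>{2..N}. g $ n * (F ^ n) $ N) \<in> multiples p S"
      proof (intro multiples_sum multiples_mult g)
        fix n assume n: "n \<in> {2..N}"
        then have "(F ^ n) $ N = (G ^ n) $ N"
          by (intro fps_power_cong_below G F) auto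
        then show "(F ^ n) $ N \<in> S"
          using int_fpsD[OF T.power_in[OF G(1)]] by simp
      qed simp
      ultimately have "g $ 1 * F $ N \<in> multiples p S"
        using multiples_diff[OF gF] by fastforce
      \<comment> \<open>For i \<ge> 1 the twists of f have no coefficient in degree 1, so dividing
        by p yields F_N exactly.\<close>
      moreover have "g $ 1 = of_nat p"
      proof -
        have "P i f $ 1 = 0" if "i \<in> {1..N}" for i
          using that p_gt_1 by (simp add: P fps_twist_nth)
        then show ?thesis
          by (simp add: g_def fps_of_nat[symmetric] fps_sum_nth f(2)[simplified])
      qed
      ultimately have "of_nat p * F $ N \<in> multiples (p * 1) S" by simp
      then have "F $ N \<in> multiples 1 S"
        by (rule multiples_cancel[OF p_pos])
      then show ?thesis by (rule multiples_subset)
    qed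
  qed
  then show ?thesis by (simp add: int_fps_def)
qed

end

section \<open>The addition of the formal group law along \<open>x = t\<close>, \<open>y = s t\<close>\<close>

text \<open>
  Here \<open>'a fps fps\<close> is read as \<open>K[[s]][[t]]\<close>: \<open>fps_lift h\<close> is \<open>h(t)\<close>, \<open>fps_scaled h\<close> is
  \<open>h(s t)\<close>, and \<open>xy_sum h\<close> is \<open>h(x) + h(y)\<close>.
\<close>

definition fps_lift :: "'a::comm_ring_1 fps \<Rightarrow> 'a fps fps" where
  "fps_lift = fps_map fps_const"

definition fps_scaled :: "'a::comm_ring_1 fps \<Rightarrow> 'a fps fps" where
  "fps_scaled h = fps_lift h oo (fps_const fps_X * fps_X)"

definition xy_sum :: "'a::comm_ring_1 fps \<Rightarrow> 'a fps fps" where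
  "xy_sum h = fps_lift h + fps_scaled h"

lemma fps_lift_nth [simp]: "fps_lift h $ n = fps_const (h $ n)"
  by (simp add: fps_lift_def)

lemma fps_scaled_nth [simp]: "fps_scaled h $ n = fps_X ^ n * fps_const (h $ n)"
  by (simp add: fps_scaled_def fps_compose_linear)

lemma unital_hom_fps_lift: "unital_hom (fps_lift :: 'a::comm_ring_1 fps \<Rightarrow> _)"
  unfolding fps_lift_def by (rule unital_hom.unital_hom_fps_map[OF unital_hom_fps_const])

lemma unital_hom_fps_scaled: "unital_hom (fps_scaled :: 'a::comm_ring_1 fps \<Rightarrow> _)"
proof -
  interpret unital_hom "fps_lift :: 'a fps \<Rightarrow> _" by (rule unital_hom_fps_lift)
  show ?thesis
    by unfold_locales
      (simp_all add: fps_scaled_def hom_simps fps_compose_add_distrib fps_compose_mult_comm_ring)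
qed

lemma fps_lift_compose: "fps_lift (A oo C) = fps_lift A oo fps_lift C"
  unfolding fps_lift_def by (rule unital_hom.fps_map_compose[OF unital_hom_fps_const])

lemma fps_of_nat_mult_compose:
  "of_nat m * A oo C = of_nat m * (A oo C)" for A C :: "'a::comm_ring_1 fps"
  by (simp add: fps_of_nat[symmetric] fps_const_mult_compose)

context unital_hom
begin

lemma fps_twist_const: "fps_twist q \<phi> (fps_const a) = fps_const (\<phi> a)" if "q > 0"
  using that by (auto simp: fps_eq_iff fps_twist_nth hom_simps elim!: dvdE)

lemma fps_twist_X: "fps_twist q \<phi> fps_X = fps_X ^ q" if "q > 0"
  using that by (simp add: fps_twist_eq_compose) 
    (auto simp: fps_eq_iff fps_compose_X_power_nth fps_X_power_nth hom_simps elim!: dvdE)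

lemma fps_twist_lift:
  assumes "r > 0"
  shows "fps_twist q (fps_twist r \<phi>) (fps_lift A) = fps_lift (fps_twist q \<phi> A)"
  by (simp add: fps_eq_iff fps_twist_nth fps_twist_const[OF assms] hom_simps)

text \<open>Both variables are raised to the same power, so s t goes to (s t)^q.\<close>

lemma fps_twist_scaled:
  assumes "q > 0"
  shows "fps_twist q (fps_twist q \<phi>) (fps_scaled A) = fps_scaled (fps_twist q \<phi> A)"
proof -
  interpret T: unital_hom "fps_twist q \<phi>" by (rule unital_hom_fps_twist[OF assms])
  show ?thesis
    using assms
    by (auto simp: fps_eq_iff[where 'a = "'b fps"] fps_twist_nth T.hom_simps fps_twist_const fps_twist_X
        hom_simps simp flip: power_mult)
qed

end

section \<open>From integrality to functional equations\<close>

context frob_ring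
begin

definition log_pair :: "'a fps \<Rightarrow> 'a fps fps \<Rightarrow> bool" where
  "log_pair f F \<longleftrightarrow> f $ 0 = 0 \<and> f $ 1 = 1 \<and> (\<forall>n. of_nat n * f $ n \<in> S) \<and>
     F \<in> int_fps (int_fps S) \<and> F $ 0 = 0 \<and> fps_lift f oo F = xy_sum f"

text \<open>The products n h_n are the coefficients of x h'(x); this form avoids an index
  shift.\<close>

definition quasi_log :: "'a fps fps \<Rightarrow> 'a fps \<Rightarrow> bool" where
  "quasi_log F h \<longleftrightarrow> (\<forall>n. of_nat n * h $ n \<in> S) \<and>
     (fps_lift h oo F) - xy_sum h \<in> multiples p (int_fps (int_fps S))"

text \<open>Inverse to substituting x^p for x, on series supported in exponents divisible by
  p.\<close>

definition fps_decimate :: "'a fps \<Rightarrow> 'a fps" where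
  "fps_decimate h = Abs_fps (\<lambda>n. h $ (p * n))"

abbreviation conj_series :: "'a fps fps \<Rightarrow> 'a fps fps" where
  "conj_series \<equiv> fps_map (fps_map \<phi>)"

section \<open>Quasi-logarithms under differentiation and decimation\<close>

lemma log_pair_conj:
  assumes "log_pair f F"
  shows "log_pair (fps_map \<phi> f) (conj_series F)"
proof -
  interpret m: unital_hom "fps_map \<phi>" by (rule unital_hom_fps_map)
  have lift: "fps_map (fps_map \<phi>) (fps_lift A) = fps_lift (fps_map \<phi> A)" for A
    by (simp add: fps_eq_iff hom_simps)
  have X: "fps_map \<phi> fps_X = fps_X"
    by (simp add: fps_eq_iff hom_simps)
  have const: "fps_map \<phi> (fps_const a) = fps_const (\<phi> a)" for a
    by (simp add: fps_eq_iff hom_simps)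
  have "fps_map (fps_map \<phi>) (xy_sum f) = xy_sum (fps_map \<phi> f)"
    by (simp add: fps_eq_iff[where 'a = "'a fps"] xy_sum_def m.hom_simps X const)
  moreover have "fps_map (fps_map \<phi>) (fps_lift f oo F) = fps_lift (fps_map \<phi> f) oo conj_series F"
    by (simp add: m.fps_map_compose lift)
  moreover have "of_nat n * \<phi> (f $ n) \<in> S" for n
    using assms hom_in[of "of_nat n * f $ n"] by (simp add: log_pair_def hom_simps)
  ultimately show ?thesis
    using assms by (auto simp: log_pair_def hom_simps m.hom_zero int_fps_def hom_in)
qed

lemma log_pair_conj_funpow:
  assumes "log_pair f F"
  shows "log_pair (fps_map (\<phi> ^^ j) f) ((conj_series ^^ j) F)"
proof (induction j)
  case 0
  have *: "fps_map (\<phi> ^^ 0) f = f" by (simp add: fps_eq_iff)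
  show ?case unfolding * using assms by simp
next
  case (Suc j)
  have *: "fps_map (\<phi> ^^ Suc j) f = fps_map \<phi> (fps_map (\<phi> ^^ j) f)" by (simp add: fps_eq_iff)
  show ?case unfolding * using log_pair_conj[OF Suc] by simp
qed

text \<open>The law F(x, 0) = x. At s = 0 the summand f(s t) vanishes, which leaves f(F) = f(t), and
  f can be cancelled on the left.\<close>

lemma log_pair_at_0:
  assumes "log_pair f F"
  shows "fps_map (\<lambda>b. b $ 0) F = fps_X"
proof -
  interpret E: unital_hom "\<lambda>A :: 'a fps. A $ 0" by (rule unital_hom_fps_nth_0)
  let ?E = "fps_map (\<lambda>b :: 'a fps. b $ 0)"
  have f: "f $ 0 = 0" "f $ 1 = 1" and F: "F $ 0 = 0" "fps_lift f oo F = xy_sum f"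
    using assms by (simp_all add: log_pair_def)
  have E_lift: "?E (fps_lift f) = f" by (simp add: fps_eq_iff)
  have "f oo ?E F = ?E (fps_lift f) oo ?E F"
    by (simp add: E_lift)
  also have "\<dots> = ?E (xy_sum f)"
    by (simp add: F(2) flip: E.fps_map_compose)
  also have "\<dots> = f"
    by (auto simp: fps_eq_iff xy_sum_def f power_0_left fps_nth_power_0)
  finally have "fps_compinv f oo (f oo ?E F) = fps_X"
    using fps_compinv(3)[OF f] by simp
  then show ?thesis
    using fps_compose_assoc_comm_ring[of "?E F" f "fps_compinv f"] fps_compinv(3)[OF f] f(1) F(1)
    by simp
qed

text \<open>
  Chain rule for the coefficient of \<open>s\<close>, that is, for the derivative in \<open>y\<close> at \<open>y = 0\<close>
  scaled by \<open>t\<close>.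
\<close>

lemma coeff_1_lift_compose:
  assumes F: "F $ 0 = 0" "fps_map (\<lambda>b. b $ 0) F = (fps_X :: 'a fps)"
  shows "fps_X * fps_map (\<lambda>b. b $ 1) (fps_lift h oo F) =
    Abs_fps (\<lambda>n. of_nat n * h $ n) * fps_map (\<lambda>b. b $ 1) F"
proof -
  interpret E: unital_hom "\<lambda>A :: 'a fps. A $ 0" by (rule unital_hom_fps_nth_0)
  interpret E': unital_hom "fps_map (\<lambda>A :: 'a fps. A $ 0)" by (rule E.unital_hom_fps_map)
  let ?E = "fps_map (\<lambda>b :: 'a fps. b $ 0)" and ?D = "fps_map (\<lambda>b :: 'a fps. b $ 1)"
  have D_mult: "?D (A * B) = ?D A * ?E B + ?E A * ?D B" for A B
    by (simp add: fps_eq_iff fps_mult_nth fps_sum_nth sum.distrib add.commute)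
  \<comment> \<open>The extra factor X turns k X^(k-1) into k X^k, so that no subtraction occurs in
    the exponent.\<close>
  have D_power: "fps_X * ?D (F ^ k) = of_nat k * fps_X ^ k * ?D F" for k
  proof (induction k)
    case 0
    show ?case by (simp add: fps_eq_iff fps_X_mult_nth)
  next
    case (Suc k)
    have "fps_X * ?D (F ^ Suc k) = fps_X ^ Suc k * ?D F + fps_X * (fps_X * ?D (F ^ k))"
      unfolding power_Suc D_mult by (simp add: E'.hom_power F(2) algebra_simps)
    also have "\<dots> = of_nat (Suc k) * fps_X ^ Suc k * ?D F"
      unfolding Suc by (simp add: algebra_simps)
    finally show ?case .
  qed
  show ?thesis
  proof (rule fps_ext)
    fix N
    have "(fps_X * ?D (fps_lift h oo F)) $ N = (\<Sum>k\<le>N. h $ k * (fps_X * ?D (F ^ k)) $ N)"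
    proof (cases N)
      case (Suc M)
      have "(fps_lift h oo F) $ M = (\<Sum>k\<le>Suc M. fps_const (h $ k) * (F ^ k) $ M)"
        using fps_compose_truncate[OF F(1), of M "Suc M"] by simp
      then show ?thesis by (simp add: Suc fps_sum_nth)
    qed simp
    also have "\<dots> = (\<Sum>k\<le>N. of_nat k * h $ k * (fps_X ^ k * ?D F) $ N)"
      unfolding D_power by (simp add: mult.assoc fps_of_nat[symmetric] mult.left_commute)
    also have "\<dots> = (Abs_fps (\<lambda>n. of_nat n * h $ n) * ?D F) $ N"
      unfolding fps_X_power_mult_nth by (simp add: fps_mult_nth atLeast0AtMost)
    finally show "(fps_X * ?D (fps_lift h oo F)) $ N = (Abs_fps (\<lambda>n. of_nat n * h $ n) * ?D F) $ N" .
  qed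
qed

lemma coeff_1_xy_sum: "fps_map (\<lambda>b. b $ 1) (xy_sum h) = fps_const (h $ 1) * (fps_X :: 'a fps)"
  by (auto simp: fps_eq_iff xy_sum_def fps_X_power_mult_nth le_Suc_eq)

text \<open>Let D be the coefficient of s. The chain rule for f gives t f' * D F = t^2; for h it
  gives t h' * D F \<equiv> 0 mod p, since the linear coefficient of h vanishes. Multiplying the
  latter by the integral series t f' replaces D F by t^2, without inverting D F.\<close>

lemma quasi_log_deriv:
  assumes fF: "log_pair f F" and h: "quasi_log F h" "h $ 1 = 0"
  shows "of_nat n * h $ n \<in> multiples p S"
proof -
  interpret F: unital_subring "int_fps S" by (rule unital_subring_int_fps)
  let ?D = "fps_map (\<lambda>b :: 'a fps. b $ 1)"
  let ?t = "\<lambda>h. Abs_fps (\<lambda>n. of_nat n * h $ n)"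
  have F: "F $ 0 = 0" "fps_lift f oo F = xy_sum f" "f $ 1 = 1" and f: "?t f \<in> int_fps S"
    using fF by (simp_all add: log_pair_def int_fps_def)
  note chain = coeff_1_lift_compose[OF F(1) log_pair_at_0[OF fF]]
  have "fps_X * fps_X = ?t f * ?D F"
    using chain[of f] by (simp only: F(2,3) coeff_1_xy_sum) simp
  moreover have "?t h * ?D F \<in> multiples p (int_fps S)"
  proof -
    have "?D ((fps_lift h oo F) - xy_sum h) \<in> multiples p (int_fps S)"
      using h(1) by (simp add: quasi_log_def multiples_int_fps_iff)
    moreover have "?D ((fps_lift h oo F) - xy_sum h) = ?D (fps_lift h oo F) - ?D (xy_sum h)"
      by (simp add: fps_eq_iff)
    ultimately have "?D (fps_lift h oo F) \<in> multiples p (int_fps S)"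
      using h(2) by (simp only: coeff_1_xy_sum) simp
    then show ?thesis
      unfolding chain[symmetric] by (intro F.multiples_mult' fps_X_int)
  qed
  ultimately have "?t h * (fps_X ^ 2) \<in> multiples p (int_fps S)"
    using F.multiples_mult'[OF f, of "?t h * ?D F"] by (simp add: power2_eq_square mult.left_commute)
  then have "(?t h * fps_X ^ 2) $ (n + 2) \<in> multiples p S"
    by (simp only: multiples_int_fps_iff)
  then show ?thesis
    by (simp add: fps_X_power_mult_right_nth)
qed

text \<open>Write h = k(x^p) + r. In exponents prime to p the factor n can be cancelled, so r
  \<equiv> 0 mod p. Hence k(F^p) \<equiv> k(x^p) + k(y^p). By \<open>compose_frob_cong\<close>, F^p
  may be replaced by \<Phi> F, a series in the p-th powers of the variables, and the substitution is
  then undone.\<close>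

lemma quasi_log_decimate:
  assumes F: "F \<in> int_fps (int_fps S)" "F $ 0 = 0" and h: "quasi_log F h"
    and h': "\<And>n. of_nat n * h $ n \<in> multiples p S"
  shows "quasi_log (conj_series F) (fps_decimate h)"
proof -
  interpret T: frob_ring "int_fps S" "fps_twist p \<phi>" p
    by (rule frob_ring_int_fps)
  interpret T': frob_ring "int_fps (int_fps S)" "fps_twist p (fps_twist p \<phi>)" p
    by (rule T.frob_ring_int_fps)
  interpret L: unital_hom "fps_lift :: 'a fps \<Rightarrow> _" by (rule unital_hom_fps_lift)
  interpret C: unital_hom "fps_scaled :: 'a fps \<Rightarrow> _" by (rule unital_hom_fps_scaled)
  interpret I: unital_hom "\<lambda>x :: 'a. x" by (rule unital_hom_id)
  interpret tw: unital_hom "fps_twist p (\<lambda>x :: 'a. x)" by (rule I.unital_hom_fps_twist[OF p_pos])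
  let ?k = "fps_decimate h"
  let ?\<psi> = "fps_twist p (\<lambda>x :: 'a. x)" and ?\<Psi> = "fps_twist p (fps_twist p (\<lambda>x :: 'a. x))"
  interpret Psi: unital_hom ?\<Psi> by (rule tw.unital_hom_fps_twist[OF p_pos])
  let ?M = "multiples p (int_fps (int_fps S))"
  have k: "of_nat n * ?k $ n \<in> S" for n
  proof -
    have "of_nat p * (of_nat n * h $ (p * n)) \<in> multiples (p * 1) S"
      using h'[of "p * n"] by (simp add: mult.assoc)
    from multiples_subset[OF multiples_cancel[OF p_pos this]]
    show ?thesis by (simp add: fps_decimate_def)
  qed
  define r where "r = h - ?\<psi> ?k"
  have r: "r \<in> multiples p (int_fps S)"
    unfolding multiples_int_fps_iff
  proof
    fix n
    show "r $ n \<in> multiples p S"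
    proof (cases "p dvd n")
      case True
      then show ?thesis by (simp add: r_def fps_twist_nth fps_decimate_def multiples_zero)
    next
      case False
      then have "coprime n p"
        using prime prime_imp_coprime coprime_commute by blast
      then show ?thesis
        using multiples_coprime[of n "h $ n" 1] h'[of n] False by (simp add: r_def fps_twist_nth)
    qed
  qed
  then obtain r' where r': "r' \<in> int_fps S" "r = of_nat p * r'" by (rule multiplesE)
  have lift_r: "fps_lift r oo F \<in> ?M"
  proof -
    have "fps_lift r' \<in> int_fps (int_fps S)"
      using r'(1) by (simp add: int_fps_def zero_in)
    moreover have "fps_lift r oo F = of_nat p * (fps_lift r' oo F)"
      by (simp add: r'(2) L.hom_simps fps_of_nat_mult_compose)
    ultimately show ?thesis
      using T.compose_int F(1) by (intro multiplesI)
  qed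
  have xy_r: "xy_sum r \<in> ?M"
  proof -
    have "fps_const (r $ n) + fps_X ^ n * fps_const (r $ n) \<in> multiples p (int_fps S)" for n
      using r by (intro T.multiples_add T.multiples_mult' T.power_in fps_X_int)
        (auto simp: multiples_int_fps_iff multiples_zero)
    then show ?thesis
      unfolding multiples_int_fps_iff[of "xy_sum r"] by (simp add: xy_sum_def)
  qed
  have psi_lift: "fps_map ?\<psi> (fps_lift ?k) = fps_lift ?k"
    by (simp add: fps_eq_iff[where 'a = "'a fps"] I.fps_twist_const p_pos)
  have "fps_lift (?\<psi> ?k) oo F = ?\<Psi> (fps_lift ?k) oo F"
    by (simp add: I.fps_twist_lift[OF p_pos])
  also have "\<dots> = fps_lift ?k oo F ^ p"
    using F(2) p_pos
    by (simp add: tw.fps_twist_compose_right psi_lift)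
  finally have psi_k: "fps_lift (?\<psi> ?k) oo F = fps_lift ?k oo F ^ p" .
  let ?\<Phi> = "fps_twist p (fps_twist p \<phi>)"
  have "(fps_lift ?k oo ?\<Phi> F) - (fps_lift ?k oo F ^ p) \<in> ?M"
  proof (rule T.compose_frob_cong)
    show "of_nat n * fps_lift ?k $ n \<in> int_fps S" for n
      using fps_const_int[OF k[of n]] by (simp add: fps_of_nat[symmetric])
  qed (use F in \<open>simp_all add: T'.hom_in T'.frob T'.power_in\<close>)
  moreover have "(fps_lift h oo F) - xy_sum h \<in> ?M"
    using h by (simp add: quasi_log_def)
  moreover have "fps_lift h = fps_lift (?\<psi> ?k) + fps_lift r" "fps_scaled h = fps_scaled (?\<psi> ?k) + fps_scaled r"
    by (simp_all add: r_def L.hom_diff C.hom_diff)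
  then have "fps_lift h oo F = (fps_lift ?k oo F ^ p) + (fps_lift r oo F)"
    and "xy_sum h = xy_sum (?\<psi> ?k) + xy_sum r"
    by (simp_all add: xy_sum_def fps_compose_add_distrib psi_k)
  ultimately have "((fps_lift ?k oo ?\<Phi> F) - (fps_lift ?k oo F ^ p)) +
      (((fps_lift ?k oo F ^ p) + (fps_lift r oo F)) - (xy_sum (?\<psi> ?k) + xy_sum r))
      - (fps_lift r oo F) + xy_sum r \<in> ?M"
    using lift_r xy_r
    by (intro T'.multiples_add[OF T'.multiples_diff[OF T'.multiples_add]]) simp_all
  then have "(fps_lift ?k oo ?\<Phi> F) - xy_sum (?\<psi> ?k) \<in> ?M"
    by simp
  \<comment> \<open>Splits \<Phi> into conjugation of the coefficients and the substitution
    \<open>?\<Psi>\<close> of s^p, t^p; only the latter is to be removed.\<close>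
  also have "?\<Phi> F = ?\<Psi> (conj_series F)"
    by (auto simp: fps_eq_iff fps_twist_nth)
  also have "fps_lift ?k oo ?\<Psi> (conj_series F) = ?\<Psi> (fps_lift ?k oo conj_series F)"
    using tw.fps_twist_compose[OF p_pos, of "conj_series F" "fps_lift ?k"] F(2)
    by (simp add: psi_lift fps_eq_iff[of "fps_map \<phi> 0"] hom_zero)
  also have "xy_sum (?\<psi> ?k) = ?\<Psi> (xy_sum ?k)"
    by (simp add: xy_sum_def Psi.hom_add I.fps_twist_lift I.fps_twist_scaled p_pos)
  finally have "?\<Psi> ((fps_lift ?k oo conj_series F) - xy_sum ?k) \<in> ?M"
    by (simp add: Psi.hom_diff)
  then have psi: "?\<Psi> ((fps_lift ?k oo conj_series F) - xy_sum ?k) $ (p * n) $ (p * m) \<in> multiples p S" for n m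
    by (simp only: multiples_int_fps_iff)
  have "(fps_lift ?k oo conj_series F) - xy_sum ?k \<in> ?M"
    unfolding multiples_int_fps_iff
  proof (intro allI)
    fix n m
    show "((fps_lift ?k oo conj_series F) - xy_sum ?k) $ n $ m \<in> multiples p S"
      using psi[of n m] p_pos by (simp add: fps_twist_nth)
  qed
  with k show ?thesis by (simp add: quasi_log_def)
qed

text \<open>The coefficient of the functional equation at the exponent p^v m. The i-th twist is
  supported on multiples of p^i, hence the sum stops at v.\<close>

definition local_functional_eq :: "(nat \<Rightarrow> 'a) \<Rightarrow> 'a fps \<Rightarrow> bool" where
  "local_functional_eq w f \<longleftrightarrow> (\<forall>v m. m > 0 \<longrightarrow> coprime m p \<longrightarrow>
     of_nat p * f $ (p ^ v * m) - (\<Sum>i=1..v. w i * (\<phi> ^^ i) (f $ (p ^ (v - i) * m))) \<in> multiples p S)"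

text \<open>\<open>w\<^sub>i\<close> is the linear coefficient of \<open>honda_seq f (i - 1)\<close>, for \<open>i \<ge> 1\<close>.\<close>

primrec honda_seq :: "'a fps \<Rightarrow> nat \<Rightarrow> 'a fps" where
  "honda_seq f 0 = fps_decimate (of_nat p * f)"
| "honda_seq f (Suc j) =
     fps_decimate (honda_seq f j - fps_const (honda_seq f j $ 1) * fps_map (\<phi> ^^ Suc j) f)"

section \<open>Honda's construction of the coefficients \<open>w i\<close>\<close>

lemma quasi_log_diff:
  assumes "log_pair f F" "quasi_log F h" "c \<in> S"
  shows "quasi_log F (h - fps_const c * f)"
proof -
  interpret L: unital_hom "fps_lift :: 'a fps \<Rightarrow> _" by (rule unital_hom_fps_lift)
  interpret C: unital_hom "fps_scaled :: 'a fps \<Rightarrow> _" by (rule unital_hom_fps_scaled)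
  have "of_nat n * (h - fps_const c * f) $ n = of_nat n * h $ n - c * (of_nat n * f $ n)" for n
    by (simp add: algebra_simps)
  moreover have "of_nat n * h $ n - c * (of_nat n * f $ n) \<in> S" for n
    using assms by (intro diff_in mult_in[OF assms(3)]) (auto simp: quasi_log_def log_pair_def)
  moreover have lc: "fps_lift (fps_const c) = fps_const (fps_const c)"
    "fps_scaled (fps_const c) = fps_const (fps_const c)"
    by (auto simp: fps_eq_iff[where 'a = "'a fps"])
  have "(fps_lift (h - fps_const c * f) oo F) - xy_sum (h - fps_const c * f) =
      ((fps_lift h oo F) - xy_sum h) - fps_const (fps_const c) * ((fps_lift f oo F) - xy_sum f)"
    by (simp add: L.hom_simps C.hom_simps xy_sum_def fps_compose_sub_distrib fps_const_mult_compose lc)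
      (simp add: algebra_simps)
  moreover have "fps_lift f oo F = xy_sum f"
    using assms(1) by (simp add: log_pair_def)
  ultimately show ?thesis
    using assms(2) by (simp add: quasi_log_def)
qed

text \<open>Conjugates of f have linear coefficient 1, so the subtraction kills the linear term as
  \<open>quasi_log_deriv\<close> requires; decimation then leads to the next conjugate of F. The
  second claim is the functional equation up to the factor n.\<close>

lemma quasi_log_honda_seq:
  assumes fF: "log_pair f F"
  shows "quasi_log ((conj_series ^^ Suc j) F) (honda_seq f j)"
    and "of_nat n * (honda_seq f j - fps_const (honda_seq f j $ 1) * fps_map (\<phi> ^^ Suc j) f) $ n
      \<in> multiples p S"
proof -
  interpret L: unital_hom "fps_lift :: 'a fps \<Rightarrow> _" by (rule unital_hom_fps_lift)
  interpret C: unital_hom "fps_scaled :: 'a fps \<Rightarrow> _" by (rule unital_hom_fps_scaled)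
  interpret F: unital_subring "int_fps S" by (rule unital_subring_int_fps)
  interpret F': unital_subring "int_fps (int_fps S)" by (rule F.unital_subring_int_fps)
  have f: "of_nat n * f $ n \<in> S" for n using fF by (simp add: log_pair_def)
  have step: "of_nat n * (h - fps_const (h $ 1) * fps_map (\<phi> ^^ j) f) $ n \<in> multiples p S"
    "quasi_log ((conj_series ^^ Suc j) F) (fps_decimate (h - fps_const (h $ 1) * fps_map (\<phi> ^^ j) f))"
    if h: "quasi_log ((conj_series ^^ j) F) h" for h j n
  proof -
    note lp = log_pair_conj_funpow[OF fF, of j]
    have "h $ 1 \<in> S"
      using h by (auto simp: quasi_log_def dest: spec[of _ 1])
    then have q: "quasi_log ((conj_series ^^ j) F) (h - fps_const (h $ 1) * fps_map (\<phi> ^^ j) f)"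
      by (rule quasi_log_diff[OF lp h])
    have 0: "(h - fps_const (h $ 1) * fps_map (\<phi> ^^ j) f) $ 1 = 0"
      using lp unfolding log_pair_def by simp
    show *: "of_nat n * (h - fps_const (h $ 1) * fps_map (\<phi> ^^ j) f) $ n \<in> multiples p S" for n
      by (rule quasi_log_deriv[OF lp q 0])
    have "quasi_log (conj_series ((conj_series ^^ j) F))
        (fps_decimate (h - fps_const (h $ 1) * fps_map (\<phi> ^^ j) f))"
      using lp by (intro quasi_log_decimate[OF _ _ q *]) (simp_all add: log_pair_def)
    then show "quasi_log ((conj_series ^^ Suc j) F)
        (fps_decimate (h - fps_const (h $ 1) * fps_map (\<phi> ^^ j) f))"
      by simp
  qed
  show q: "quasi_log ((conj_series ^^ Suc j) F) (honda_seq f j)" for j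
  proof (induction j)
    case 0
    \<comment> \<open>The starting series p f has linear coefficient p, not 0, but here the
      divisibility is immediate; hence the first decimation comes without a subtraction.\<close>
    have pf: "of_nat n * (of_nat p * f) $ n \<in> multiples p S" for n
      using f[of n] by (intro multiplesI[of "of_nat n * f $ n"])
        (simp_all add: fps_of_nat[symmetric] mult.left_commute)
    have "quasi_log F (of_nat p * f)"
      using fF multiples_subset[OF pf] F'.multiples_zero
      by (simp add: quasi_log_def log_pair_def L.hom_simps C.hom_simps xy_sum_def
          fps_of_nat_mult_compose distrib_left)
    then show ?case
      using fF by (auto simp: log_pair_def intro!: quasi_log_decimate pf)
  next
    case (Suc j)
    show ?case
      unfolding honda_seq.simps by (rule step(2)[OF Suc])
  qed
  show "of_nat n * (honda_seq f j - fps_const (honda_seq f j $ 1) * fps_map (\<phi> ^^ Suc j) f) $ n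
      \<in> multiples p S"
    by (rule step(1)[OF q])
qed

text \<open>Every decimation multiplies the index by p. The result is the left side of the
  functional equation at the exponent p^(j+1) n, with the summand i = j + 1 still missing; the next
  subtraction supplies it.\<close>

lemma honda_seq_nth:
  "honda_seq f j $ n = of_nat p * f $ (p ^ Suc j * n) -
     (\<Sum>i=1..j. honda_seq f (i - 1) $ 1 * (\<phi> ^^ i) (f $ (p ^ (Suc j - i) * n)))"
proof (induction j arbitrary: n)
  case 0
  show ?case by (simp add: fps_decimate_def fps_of_nat[symmetric])
next
  case (Suc j)
  have "honda_seq f (Suc j) $ n = honda_seq f j $ (p * n) -
      honda_seq f j $ 1 * (\<phi> ^^ Suc j) (f $ (p * n))"
    by (simp add: fps_decimate_def)
  also have "\<dots> = of_nat p * f $ (p ^ Suc (Suc j) * n) -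
     (\<Sum>i=1..Suc j. honda_seq f (i - 1) $ 1 * (\<phi> ^^ i) (f $ (p ^ (Suc (Suc j) - i) * n)))"
  proof -
    have idx: "p ^ (Suc j - i) * (p * n) = p ^ (Suc (Suc j) - i) * n" if "i \<le> Suc j" for i
      using that by (simp add: Suc_diff_le)
    have "(\<Sum>i=1..j. honda_seq f (i - 1) $ 1 * (\<phi> ^^ i) (f $ (p ^ (Suc j - i) * (p * n)))) =
        (\<Sum>i=1..j. honda_seq f (i - 1) $ 1 * (\<phi> ^^ i) (f $ (p ^ (Suc (Suc j) - i) * n)))"
      by (intro sum.cong refl) (subst idx, auto)
    then show ?thesis
      using Suc[of "p * n"] by (simp add: mult_ac)
  qed
  finally show ?case .
qed

text \<open>The third conclusion is an equality rather than a congruence. As f has linear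
  coefficient 1, it determines the \<open>w i\<close> with i > 0 recursively, which allows the
  comparison with the p-sequence.\<close>

lemma log_pair_local_functional_eq:
  assumes fF: "log_pair f F"
  obtains w where "\<And>i. w i \<in> S" "local_functional_eq w f"
    "\<And>v. v > 0 \<Longrightarrow> of_nat p * f $ (p ^ v) = (\<Sum>i=1..v. w i * (\<phi> ^^ i) (f $ (p ^ (v - i))))"
proof
  \<comment> \<open>The value at i = 0 is a dummy, since all sums start at 1.\<close>
  define w where "w i = honda_seq f (i - 1) $ 1" for i
  have w_in: "honda_seq f j $ 1 \<in> S" for j
    using quasi_log_honda_seq(1)[OF fF, of j] by (auto simp: quasi_log_def dest: spec[of _ 1])
  then show "w i \<in> S" for i by (simp add: w_def)
  have eq: "(honda_seq f j - fps_const (honda_seq f j $ 1) * fps_map (\<phi> ^^ Suc j) f) $ m =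
      of_nat p * f $ (p ^ Suc j * m) - (\<Sum>i=1..Suc j. w i * (\<phi> ^^ i) (f $ (p ^ (Suc j - i) * m)))" for j m
    by (simp add: honda_seq_nth[of f j m] w_def)
  show "local_functional_eq w f"
    unfolding local_functional_eq_def
  proof (intro allI impI)
    fix v m assume m: "0 < m" "coprime m p"
    show "of_nat p * f $ (p ^ v * m) - (\<Sum>i=1..v. w i * (\<phi> ^^ i) (f $ (p ^ (v - i) * m))) \<in> multiples p S"
    proof (cases v)
      case 0
      have "of_nat m * f $ m \<in> S" using fF by (simp add: log_pair_def)
      then show ?thesis
        using coprime_divide[OF m(2)] by (auto simp: 0 intro: multiplesI)
    next
      case (Suc j)
      have "of_nat m * (honda_seq f j - fps_const (honda_seq f j $ 1) * fps_map (\<phi> ^^ Suc j) f) $ m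
          \<in> multiples (p ^ 1) S"
        using quasi_log_honda_seq(2)[OF fF] by simp
      from multiples_coprime[OF m(2) this] show ?thesis
        unfolding eq Suc by simp
    qed
  qed
  show "of_nat p * f $ (p ^ v) = (\<Sum>i=1..v. w i * (\<phi> ^^ i) (f $ (p ^ (v - i))))" if "v > 0" for v
  proof -
    from that obtain j where v: "v = Suc j" by (cases v) auto
    have "fps_map (\<phi> ^^ Suc j) f $ 1 = 1"
      using log_pair_conj_funpow[OF fF, of "Suc j"] unfolding log_pair_def by blast
    \<comment> \<open>Exactness at powers of p is the vanishing of the linear coefficient after the
      subtraction.\<close>
    then have "(honda_seq f j - fps_const (honda_seq f j $ 1) * fps_map (\<phi> ^^ Suc j) f) $ 1 = 0"
      by simp
    then show ?thesis unfolding eq v by simp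
  qed
qed

section \<open>From the coefficientwise equation to integrality of the group law\<close>

lemma functional_eq_of_local:
  assumes f0: "f $ 0 = 0" and loc: "local_functional_eq w f"
  shows "functional_eq w f"
  unfolding functional_eq_def
proof (intro allI impI)
  fix N n :: nat assume "n \<le> N"
  have hom0: "(\<phi> ^^ i) 0 = 0" for i
    by (induction i) (simp_all add: hom_zero)
  have tw: "(fps_twist p \<phi> ^^ i) f $ n = (if p ^ i dvd n then (\<phi> ^^ i) (f $ (n div p ^ i)) else 0)" for i
    by (simp add: fps_twist_funpow[where \<phi> = \<phi>, OF p_pos hom_zero] fps_twist_nth)
  have nth: "(of_nat p * f - (\<Sum>i=1..N. fps_const (w i) * (fps_twist p \<phi> ^^ i) f)) $ n =
      of_nat p * f $ n - (\<Sum>i=1..N. w i * (if p ^ i dvd n then (\<phi> ^^ i) (f $ (n div p ^ i)) else 0))"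
    by (simp add: fps_sum_nth fps_of_nat[symmetric] tw)
  show "(of_nat p * f - (\<Sum>i=1..N. fps_const (w i) * (fps_twist p \<phi> ^^ i) f)) $ n \<in> multiples p S"
  proof (cases "n = 0")
    case True
    then show ?thesis unfolding nth by (simp add: f0 hom0 multiples_zero)
  next
    case False
    obtain v m where nm: "n = p ^ v * m" "\<not> p dvd m"
      using multiplicity_decompose'[of n p] False prime by (metis not_prime_unit)
    then have m: "m > 0" "coprime m p"
      using prime prime_imp_coprime[of p m] False by (auto simp: coprime_commute)
    have "v \<le> N"
    proof -
      have "v < p ^ v" using p_gt_1 by (simp add: power_gt_expt)
      also have "p ^ v \<le> n" using nm m by simp
      finally show ?thesis using \<open>n \<le> N\<close> by simp
    qed
    have dvd: "p ^ i dvd n \<longleftrightarrow> i \<le> v" for i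
    proof
      assume "p ^ i dvd n"
      then have "p ^ i dvd p ^ v"
        using m(2) unfolding nm(1) by (simp add: coprime_commute coprime_dvd_mult_left_iff)
      then show "i \<le> v" using p_gt_1 power_dvd_imp_le by blast
    qed (simp add: nm(1) le_imp_power_dvd)
    have "(\<Sum>i=1..N. w i * (if p ^ i dvd n then (\<phi> ^^ i) (f $ (n div p ^ i)) else 0)) =
        (\<Sum>i=1..v. w i * (\<phi> ^^ i) (f $ (p ^ (v - i) * m)))"
    proof (rule sum.mono_neutral_cong_right)
      fix i assume "i \<in> {1..v}"
      then have "n = p ^ i * (p ^ (v - i) * m)"
        by (simp add: nm(1) flip: mult.assoc power_add)
      then have "n div p ^ i = p ^ (v - i) * m"
        using p_pos by simp
      then show "w i * (if p ^ i dvd n then (\<phi> ^^ i) (f $ (n div p ^ i)) else 0) =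
          w i * (\<phi> ^^ i) (f $ (p ^ (v - i) * m))"
        using \<open>i \<in> {1..v}\<close> by (simp add: dvd)
    qed (use \<open>v \<le> N\<close> in \<open>auto simp: dvd\<close>)
    then show ?thesis
      unfolding nth using loc m by (simp add: local_functional_eq_def nm(1))
  qed
qed

text \<open>Apply \<open>functional_eq_integral\<close> over the series in s. Both h(t) and h(s t)
  depend on h through ring homomorphisms commuting with the twists, so f(t) and f(t) + f(s t)
  satisfy the same functional equation.\<close>

lemma local_functional_eq_imp_integral:
  assumes f: "f $ 0 = 0" "f $ 1 = 1" "\<And>n. of_nat n * f $ n \<in> S"
    and w: "\<And>i. w i \<in> S" and loc: "local_functional_eq w f"
    and F: "F $ 0 = 0" "fps_lift f oo F = xy_sum f"
  shows "F \<in> int_fps (int_fps S)"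
proof -
  interpret T: frob_ring "int_fps S" "fps_twist p \<phi>" p
    by (rule frob_ring_int_fps)
  have fe: "functional_eq w f" by (rule functional_eq_of_local[OF f(1) loc])
  have transfer: "(of_nat p * E f - (\<Sum>i=1..N. fps_const (fps_const (w i)) * (fps_twist p (fps_twist p \<phi>) ^^ i) (E f))) $ n
      \<in> multiples p (int_fps S)"
    if "unital_hom E" "\<And>A. fps_twist p (fps_twist p \<phi>) (E A) = E (fps_twist p \<phi> A)"
      "\<And>c. E (fps_const c) = fps_const (fps_const c)"
      "\<And>A n. A $ n \<in> multiples p S \<Longrightarrow> E A $ n \<in> multiples p (int_fps S)" "n \<le> N"
    for E N n
  proof -
    interpret E: unital_hom E by (rule that(1))
    have "(fps_twist p (fps_twist p \<phi>) ^^ i) (E f) = E ((fps_twist p \<phi> ^^ i) f)" for i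
      by (induction i) (simp_all add: that(2))
    then have "of_nat p * E f - (\<Sum>i=1..N. fps_const (fps_const (w i)) * (fps_twist p (fps_twist p \<phi>) ^^ i) (E f)) =
        E (of_nat p * f - (\<Sum>i=1..N. fps_const (w i) * (fps_twist p \<phi> ^^ i) f))"
      by (simp add: E.hom_simps that(3))
    then show ?thesis
      using fe that(4,5) by (simp add: functional_eq_def)
  qed
  have const: "fps_const c \<in> multiples p (int_fps S)" if "c \<in> multiples p S" for c
    using that by (simp add: multiples_int_fps_iff multiples_zero)
  have lift: "(of_nat p * fps_lift f - (\<Sum>i=1..N. fps_const (fps_const (w i)) *
      (fps_twist p (fps_twist p \<phi>) ^^ i) (fps_lift f))) $ n \<in> multiples p (int_fps S)" if "n \<le> N" for n N
    using that
    by (intro transfer unital_hom_fps_lift fps_twist_lift p_pos)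
      (auto simp: const fps_eq_iff[where 'a = "'a fps"])
  have scaled: "(of_nat p * fps_scaled f - (\<Sum>i=1..N. fps_const (fps_const (w i)) *
      (fps_twist p (fps_twist p \<phi>) ^^ i) (fps_scaled f))) $ n \<in> multiples p (int_fps S)" if "n \<le> N" for n N
    using that
    by (intro transfer unital_hom_fps_scaled fps_twist_scaled p_pos)
      (auto simp: fps_eq_iff[where 'a = "'a fps"] intro!: T.multiples_mult' const T.power_in fps_X_int)
  show ?thesis
  proof (rule T.functional_eq_integral)
    show "T.functional_eq (\<lambda>i. fps_const (w i)) (fps_lift f)"
      using lift by (simp add: T.functional_eq_def)
    have "unital_hom (fps_twist p (fps_twist p \<phi>) ^^ i)" for i
      by (intro unital_hom_funpow T.unital_hom_fps_twist p_pos)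
    then have add: "(fps_twist p (fps_twist p \<phi>) ^^ i) (A + B) =
        (fps_twist p (fps_twist p \<phi>) ^^ i) A + (fps_twist p (fps_twist p \<phi>) ^^ i) B" for i A B
      by (simp add: unital_hom_def)
    show "T.functional_eq (\<lambda>i. fps_const (w i)) (xy_sum f)"
      unfolding T.functional_eq_def
    proof (intro allI impI)
      fix N n :: nat assume "n \<le> N"
      from T.multiples_add[OF lift[OF this] scaled[OF this]]
      show "(of_nat p * xy_sum f - (\<Sum>i=1..N. fps_const (fps_const (w i)) *
          (fps_twist p (fps_twist p \<phi>) ^^ i) (xy_sum f))) $ n \<in> multiples p (int_fps S)"
        by (simp add: xy_sum_def add sum.distrib algebra_simps fps_sum_nth)
    qed
    show "of_nat n * fps_lift f $ n \<in> int_fps S" for n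
      using fps_const_int[OF f(3)[of n]] by (simp add: fps_of_nat[symmetric])
  qed (use f w F in \<open>simp_all add: fps_const_int\<close>)
qed

end

section \<open>Restriction of two-variable series to \<open>x = t\<close>, \<open>y = s t\<close>\<close>

text \<open>The series \<open>A(t, s t)\<close> in \<open>K[[s]][[t]]\<close>; total degree becomes degree in \<open>t\<close>.\<close>

definition fps_homog :: "'a::comm_ring_1 fps fps \<Rightarrow> 'a fps fps" where
  "fps_homog A = Abs_fps (\<lambda>N. Abs_fps (\<lambda>j. if j \<le> N then A $ j $ (N - j) else 0))"

lemma fps_homog_nth: "fps_homog A $ N $ j = (if j \<le> N then A $ j $ (N - j) else 0)"
  by (simp add: fps_homog_def)

lemma fps_homog_mult: "fps_homog (A * B) = fps_homog A * fps_homog B"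
proof (intro fps_ext)
  fix N j
  have "(fps_homog A * fps_homog B) $ N $ j =
      (\<Sum>M\<le>N. \<Sum>j'\<le>j. fps_homog A $ M $ j' * fps_homog B $ (N - M) $ (j - j'))"
    by (simp add: fps_mult_nth fps_sum_nth atLeast0AtMost)
  also have "\<dots> = (\<Sum>j'\<le>j. \<Sum>M\<le>N. fps_homog A $ M $ j' * fps_homog B $ (N - M) $ (j - j'))"
    by (rule sum.swap)
  also have "\<dots> = (if j \<le> N then \<Sum>j'\<le>j. \<Sum>i'\<le>N - j. A $ j' $ i' * B $ (j - j') $ (N - j - i') else 0)"
  proof (cases "j \<le> N")
    case True
    have "(\<Sum>M\<le>N. fps_homog A $ M $ j' * fps_homog B $ (N - M) $ (j - j')) =
        (\<Sum>i'\<le>N - j. A $ j' $ i' * B $ (j - j') $ (N - j - i'))" if "j' \<le> j" for j'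
    proof -
      \<comment> \<open>Both truncation conditions hold exactly for M = i' + j' with i' \<le> N -
        j.\<close>
      have "(\<Sum>M\<le>N. fps_homog A $ M $ j' * fps_homog B $ (N - M) $ (j - j')) =
          (\<Sum>M\<in>(\<lambda>i'. i' + j') ` {..N - j}. A $ j' $ (M - j') * B $ (j - j') $ (N - M - (j - j')))"
      proof (rule sum.mono_neutral_cong_right)
        show "\<forall>M\<in>{..N} - (\<lambda>i'. i' + j') ` {..N - j}.
            fps_homog A $ M $ j' * fps_homog B $ (N - M) $ (j - j') = 0"
        proof
          fix M assume M: "M \<in> {..N} - (\<lambda>i'. i' + j') ` {..N - j}"
          have "\<not> (j' \<le> M \<and> j - j' \<le> N - M)"
          proof
            assume "j' \<le> M \<and> j - j' \<le> N - M"
            then have "M = (M - j') + j'" "M - j' \<in> {..N - j}"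
              using True that M by auto
            then show False using M by (metis DiffD2 image_eqI)
          qed
          then show "fps_homog A $ M $ j' * fps_homog B $ (N - M) $ (j - j') = 0"
            by (auto simp: fps_homog_nth)
        qed
      qed (use True that in \<open>auto simp: fps_homog_nth\<close>)
      also have "\<dots> = (\<Sum>i'\<le>N - j. A $ j' $ i' * B $ (j - j') $ (N - j - i'))"
        using True that by (subst sum.reindex) (auto intro!: sum.cong arg_cong2[of _ _ _ _ "(*)"]
            arg_cong[of _ _ "\<lambda>n. B $ (j - j') $ n"] simp: inj_on_def)
      finally show ?thesis .
    qed
    with True show ?thesis by simp
  next
    case False
    have "fps_homog A $ M $ j' * fps_homog B $ (N - M) $ (j - j') = 0" if "M \<le> N" "j' \<le> j" for M j'
      using False that by (auto simp: fps_homog_nth)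
    with False show ?thesis by simp
  qed
  also have "\<dots> = fps_homog (A * B) $ N $ j"
    by (simp add: fps_homog_nth fps_mult_nth fps_sum_nth atLeast0AtMost)
  finally show "fps_homog (A * B) $ N $ j = (fps_homog A * fps_homog B) $ N $ j" ..
qed

lemma unital_hom_fps_homog: "unital_hom (fps_homog :: 'a::comm_ring_1 fps fps \<Rightarrow> _)"
proof
  show "fps_homog (1 :: 'a fps fps) = 1"
    by (intro fps_ext) (auto simp: fps_homog_nth)
  show "fps_homog (A + B) = fps_homog A + fps_homog B" for A B :: "'a fps fps"
    by (intro fps_ext) (simp add: fps_homog_nth)
qed (rule fps_homog_mult)

text \<open>The degree in t is the total degree, so the cutoff k \<le> i + j in
  \<open>fps_subst2\<close> becomes the usual cutoff k \<le> N of a composition.\<close>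

lemma fps_homog_subst2: "fps_homog (fps_subst2 g h) = fps_lift g oo fps_homog h"
proof (intro fps_ext)
  interpret H: unital_hom "fps_homog :: 'a fps fps \<Rightarrow> _" by (rule unital_hom_fps_homog)
  fix N j
  have "(fps_lift g oo fps_homog h) $ N $ j = (\<Sum>k\<le>N. g $ k * fps_homog (h ^ k) $ N $ j)"
    by (simp add: fps_compose_nth fps_sum_nth H.hom_power atLeast0AtMost)
  then show "fps_homog (fps_subst2 g h) $ N $ j = (fps_lift g oo fps_homog h) $ N $ j"
    by (simp add: fps_homog_nth fps_subst2_def)
qed

lemma fps_homog_in_x: "fps_homog (fps_in_x f) = fps_lift f"
  by (intro fps_ext) (auto simp: fps_homog_nth fps_in_x_def)

lemma fps_homog_in_y: "fps_homog (fps_in_y f) = fps_scaled f"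
  by (intro fps_ext) (auto simp: fps_homog_nth fps_in_y_def fps_X_power_mult_nth)

text \<open>In the variable t the law is an ordinary composition, so associativity cancels f against
  its inverse. The conclusions are the conditions on F in \<open>log_pair\<close> that do not
  concern integrality.\<close>

lemma fps_homog_formal_group_law:
  assumes f: "f $ 0 = 0" "f $ 1 = 1"
  shows "fps_homog (formal_group_law f) $ 0 = 0"
    and "fps_lift f oo fps_homog (formal_group_law f) = xy_sum f"
proof -
  interpret H: unital_hom "fps_homog :: 'a fps fps \<Rightarrow> _" by (rule unital_hom_fps_homog)
  have F: "fps_homog (formal_group_law f) = fps_lift (fps_compinv f) oo xy_sum f"
    by (simp add: formal_group_law_def fps_homog_subst2 H.hom_add fps_homog_in_x fps_homog_in_y xy_sum_def)
  have 0: "xy_sum f $ 0 = 0" "fps_lift (fps_compinv f) $ 0 = 0"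
    using f(1) fps_compinv(1)[OF f] by (simp_all add: xy_sum_def)
  show "fps_homog (formal_group_law f) $ 0 = 0"
    using 0(2) by (simp add: F del: fps_lift_nth)
  have "fps_lift f oo fps_homog (formal_group_law f) = fps_lift (f oo fps_compinv f) oo xy_sum f"
    by (simp add: F fps_compose_assoc_comm_ring[OF 0] fps_lift_compose)
  also have "\<dots> = fps_X oo xy_sum f"
    unfolding fps_compinv(2)[OF f] by (rule arg_cong[of _ _ "\<lambda>g. g oo _"]) (auto simp: fps_eq_iff)
  also have "\<dots> = xy_sum f" using 0(1) by simp
  finally show "fps_lift f oo fps_homog (formal_group_law f) = xy_sum f" .
qed

lemma fps_homog_int_iff:
  assumes "0 \<in> S"
  shows "fps_homog A \<in> int_fps (int_fps S) \<longleftrightarrow> (\<forall>i j. A $ j $ i \<in> S)"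
proof
  assume *: "fps_homog A \<in> int_fps (int_fps S)"
  show "\<forall>i j. A $ j $ i \<in> S"
  proof (intro allI)
    fix i j
    have "fps_homog A $ (i + j) $ j \<in> S" using * by (simp add: int_fps_def)
    then show "A $ j $ i \<in> S" by (simp add: fps_homog_nth)
  qed
qed (use assms in \<open>simp add: int_fps_def fps_homog_nth\<close>)

section \<open>Localising \<open>R \<otimes> \<rat>\<close> at a prime\<close>

text \<open>A bare function need not respect equality of fractions; for a ring endomorphism the
  description is unique, by \<open>tensor_map_frac\<close>.\<close>

definition tensor_map :: "('a::comm_ring_1 \<Rightarrow> 'a) \<Rightarrow> 'a tensor_rat \<Rightarrow> 'a tensor_rat" where
  "tensor_map \<sigma> z = (THE w. \<exists>r n. n > 0 \<and> z = tensor_frac r n \<and> w = tensor_frac (\<sigma> r) n)"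

definition p_local :: "nat \<Rightarrow> 'a::comm_ring_1 tensor_rat set" where
  "p_local p = {tensor_frac r n | r n. coprime n p \<and> n > 0}"

lemma unital_hom_frobenius_lift: "frobenius_lift p \<sigma> \<Longrightarrow> unital_hom \<sigma>"
  by unfold_locales (simp_all add: frobenius_lift_def)

lemma tensor_map_frac:
  assumes "unital_hom \<sigma>" "n > 0"
  shows "tensor_map \<sigma> (tensor_frac r n) = tensor_frac (\<sigma> r) n"
  unfolding tensor_map_def
proof (rule the_equality)
  interpret unital_hom \<sigma> by (rule assms(1))
  fix w assume "\<exists>s m. m > 0 \<and> tensor_frac r n = tensor_frac s m \<and> w = tensor_frac (\<sigma> s) m"
  then obtain s m where sm: "m > 0" "tensor_frac r n = tensor_frac s m" "w = tensor_frac (\<sigma> s) m"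
    by blast
  then obtain k where k: "k > 0" "of_nat k * (r * of_nat m) = of_nat k * (s * of_nat n)"
    using tensor_frac_eq_iff[OF assms(2) sm(1)] by blast
  have "of_nat k * (\<sigma> r * of_nat m) = of_nat k * (\<sigma> s * of_nat n)"
    using arg_cong[OF k(2), of \<sigma>] by (simp add: hom_simps)
  then show "w = tensor_frac (\<sigma> r) n"
    using k(1) assms sm by (auto simp: tensor_frac_eq_iff)
qed (use assms in blast)

lemma tensor_torsion_free:
  fixes z :: "'a::{comm_ring_1, ring_char_0} tensor_rat"
  assumes "n > 0" "of_nat n * z = 0"
  shows "z = 0"
proof -
  obtain r m where z: "z = tensor_frac r m" "m > 0" by (cases z)
  have "tensor_frac (of_nat n * r) m = tensor_frac 0 1"
    using assms(2) z
    by (simp add: base_to_tensor_of_nat[symmetric] base_to_tensor_def tensor_frac_mult tensor_frac_0)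
  then obtain k where "k > 0" "of_nat k * (of_nat n * r) = 0"
    using z(2) by (auto simp: tensor_frac_eq_iff)
  then show ?thesis
    using z assms(1) by (auto simp: tensor_frac_0 tensor_frac_eq_iff mult.assoc intro!: exI[of _ "k * n"])
qed

lemma tensor_cancel:
  fixes x y :: "'a::{comm_ring_1, ring_char_0} tensor_rat"
  assumes "n > 0" "of_nat n * x = of_nat n * y"
  shows "x = y"
  using tensor_torsion_free[of n "x - y"] assms by (simp add: right_diff_distrib)

lemma base_to_tensor_hom_unital: 
  "unital_hom (base_to_tensor :: 'a::{comm_ring_1, ring_char_0} \<Rightarrow> _)"
  by unfold_locales (simp_all add: base_to_tensor_hom)

lemma p_local_iff:
  fixes z :: "'a::{comm_ring_1, ring_char_0} tensor_rat"
  shows "z \<in> p_local p \<longleftrightarrow> (\<exists>n>0. coprime n p \<and> of_nat n * z \<in> range base_to_tensor)"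
proof
  assume "z \<in> p_local p"
  then show "\<exists>n>0. coprime n p \<and> of_nat n * z \<in> range base_to_tensor"
    by (auto simp: p_local_def of_nat_mult_tensor_frac)
next
  assume "\<exists>n>0. coprime n p \<and> of_nat n * z \<in> range base_to_tensor"
  then obtain n r where n: "n > 0" "coprime n p" "of_nat n * z = base_to_tensor r" by blast
  then have "z = tensor_frac r n"
    using tensor_cancel[OF n(1), of z "tensor_frac r n"] by (simp add: of_nat_mult_tensor_frac)
  with n show "z \<in> p_local p" by (auto simp: p_local_def)
qed

text \<open>For x = r/n, the error of x is (\<sigma>(r) n^p - r^p n) / n^(p+1). The numerator is
  divisible by p because \<sigma>(r) \<equiv> r^p and n \<equiv> n^p, and the denominator is prime
  to p.\<close>

lemma frob_ring_p_local:
  fixes \<sigma> :: "'a::{comm_ring_1, ring_char_0} \<Rightarrow> 'a"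
  assumes p: "prime p" and \<sigma>: "frobenius_lift p \<sigma>"
  shows "frob_ring (p_local p) (tensor_map \<sigma>) p"
proof -
  interpret \<sigma>: unital_hom \<sigma> by (rule unital_hom_frobenius_lift[OF \<sigma>])
  interpret base: unital_hom "base_to_tensor :: 'a \<Rightarrow> _" by (rule base_to_tensor_hom_unital)
  note frac = tensor_map_frac[OF \<sigma>.unital_hom_axioms]
  show ?thesis
  proof
    show "1 \<in> p_local p"
      by (auto simp: p_local_def tensor_frac_1 intro!: exI[of _ 1])
    show "x + y \<in> p_local p" "x * y \<in> p_local p" if xy: "x \<in> p_local p" "y \<in> p_local p"
      for x y :: "'a tensor_rat"
    proof -
      obtain r m s n where xy: "x = tensor_frac r m" "y = tensor_frac s n"
        and mn: "m > 0" "n > 0" "coprime m p" "coprime n p"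
        using xy by (auto simp: p_local_def)
      then have "coprime (m * n) p" by simp
      then show "x + y \<in> p_local p" "x * y \<in> p_local p"
        using mn unfolding xy p_local_def
        by (auto simp: tensor_frac_add tensor_frac_mult simp del: coprime_mult_left_iff
            intro!: exI[of _ "m * n"])
    qed
    show "- x \<in> p_local p" if "x \<in> p_local p" for x :: "'a tensor_rat"
      using that unfolding p_local_def by (force simp: tensor_frac_uminus)
    show "tensor_map \<sigma> 1 = 1"
      by (simp add: tensor_frac_1 frac \<sigma>.hom_one)
    fix x y :: "'a tensor_rat"
    obtain r m s n where xy: "x = tensor_frac r m" "y = tensor_frac s n" and mn: "m > 0" "n > 0"
      by (metis tensor_frac_cases)
    show "tensor_map \<sigma> (x + y) = tensor_map \<sigma> x + tensor_map \<sigma> y"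
      "tensor_map \<sigma> (x * y) = tensor_map \<sigma> x * tensor_map \<sigma> y"
      using mn by (simp_all add: xy tensor_frac_add tensor_frac_mult frac \<sigma>.hom_simps)
  next
    fix x :: "'a tensor_rat" assume "x \<in> p_local p"
    then obtain r n where x: "x = tensor_frac r n" "n > 0" "coprime n p"
      by (auto simp: p_local_def)
    have nx: "of_nat n * x = base_to_tensor r" "of_nat n * tensor_map \<sigma> x = base_to_tensor (\<sigma> r)"
      using x by (simp_all add: frac of_nat_mult_tensor_frac)
    \<comment> \<open>Fermat's congruence n \<equiv> n^p is the Frobenius condition at n, which
      \<sigma> fixes.\<close>
    have "of_nat p dvd \<sigma> r - r ^ p" "of_nat p dvd \<sigma> (of_nat n) - of_nat n ^ p"
      using \<sigma> by (simp_all add: frobenius_lift_def)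
    then obtain t u where t: "\<sigma> r - r ^ p = of_nat p * t" and u: "(of_nat n :: 'a) - of_nat n ^ p = of_nat p * u"
      unfolding \<sigma>.hom_of_nat dvd_def by blast
    define y where "y = t * of_nat n ^ p - r ^ p * u"
    have y: "\<sigma> r * of_nat n ^ p - r ^ p * of_nat n = of_nat p * y"
    proof -
      have "\<sigma> r = r ^ p + of_nat p * t" "of_nat n = of_nat n ^ p + of_nat p * u"
        using t u by (simp_all add: algebra_simps)
      then have "\<sigma> r * of_nat n ^ p - r ^ p * of_nat n =
          (r ^ p + of_nat p * t) * of_nat n ^ p - r ^ p * (of_nat n ^ p + of_nat p * u)"
        by simp
      then show ?thesis by (simp add: y_def algebra_simps)
    qed
    have "of_nat (n ^ p * n) * (tensor_map \<sigma> x - x ^ p) =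
        of_nat n ^ p * (of_nat n * tensor_map \<sigma> x) - of_nat n * (of_nat n * x) ^ p"
      by (simp add: algebra_simps power_mult_distrib)
    also have "\<dots> = base_to_tensor (\<sigma> r * of_nat n ^ p - r ^ p * of_nat n)"
      unfolding nx by (simp add: base.hom_simps mult.commute)
    also have "\<dots> = of_nat (n ^ p * n) * (of_nat p * tensor_frac y (n ^ p * n))"
      unfolding y using x(2) of_nat_mult_tensor_frac[of "n ^ p * n" y]
      by (simp only: base.hom_mult base.hom_of_nat mult.left_commute[of "of_nat (n ^ p * n)"]) simp
    finally have "tensor_map \<sigma> x - x ^ p = of_nat p * tensor_frac y (n ^ p * n)"
      by (rule tensor_cancel[rotated]) (use x(2) in simp)
    moreover have "tensor_frac y (n ^ p * n) \<in> p_local p"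
      using x(2,3) by (auto simp: p_local_def intro!: exI[of _ "n ^ p * n"] exI[of _ y])
    ultimately show "tensor_map \<sigma> x - x ^ p \<in> multiples p (p_local p)"
      by (rule multiplesI[rotated])
  next
    fix n and x :: "'a tensor_rat"
    assume n: "coprime n p" and x: "of_nat n * x \<in> p_local p"
    then obtain m where m: "m > 0" "coprime m p" "of_nat m * (of_nat n * x) \<in> range base_to_tensor"
      by (auto simp: p_local_iff)
    have "n > 0" using n p by (cases n) auto
    then show "x \<in> p_local p"
      using m n by (auto simp: p_local_iff mult.assoc intro!: exI[of _ "m * n"])
  qed (use p in \<open>auto intro: tensor_torsion_free\<close>)
qed

lemma base_to_tensor_p_local: "base_to_tensor r \<in> p_local p"
  by (auto simp: p_local_def base_to_tensor_def intro!: exI[of _ r] exI[of _ "1 :: nat"])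

text \<open>By Bezout the denominators of z are closed under gcd. If the least one had a prime
  factor p, its gcd with a denominator prime to p would be smaller.\<close>

lemma range_base_eq_Inter_p_local:
  fixes z :: "'a::{comm_ring_1, ring_char_0} tensor_rat"
  shows "z \<in> range base_to_tensor \<longleftrightarrow> (\<forall>p. prime p \<longrightarrow> z \<in> p_local p)"
proof
  interpret base: unital_hom "base_to_tensor :: 'a \<Rightarrow> _" by (rule base_to_tensor_hom_unital)
  assume *: "\<forall>p. prime p \<longrightarrow> z \<in> p_local p"
  define I where "I = {n. n > 0 \<and> of_nat n * z \<in> range base_to_tensor}"
  define n where "n = (LEAST n. n \<in> I)"
  have "I \<noteq> {}" using *[rule_format, OF two_is_prime_nat] by (auto simp: p_local_iff I_def)
  then have n: "n \<in> I" unfolding n_def by (auto intro: LeastI)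
  have "n = 1"
  proof (rule ccontr)
    assume "n \<noteq> 1"
    then obtain p where p: "prime p" "p dvd n" using prime_factor_nat by blast
    then obtain m where m: "m > 0" "coprime m p" "of_nat m * z \<in> range base_to_tensor"
      using * by (auto simp: p_local_iff)
    obtain r s where rs: "of_nat n * z = base_to_tensor r" "of_nat m * z = base_to_tensor s"
      using n m(3) by (auto simp: I_def)
    obtain u v where uv: "u * int n + v * int m = int (gcd n m)"
      using bezout_int[of "int n" "int m"] by auto
    have base_int: "base_to_tensor (of_int k) = (of_int k :: 'a tensor_rat)" for k
      by (cases k) (simp_all add: base.hom_simps)
    have "of_nat (gcd n m) * z = of_int (u * int n + v * int m) * z"
      unfolding uv by simp
    also have "\<dots> = of_int u * (of_nat n * z) + of_int v * (of_nat m * z)"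
      by (simp add: algebra_simps)
    also have "\<dots> = base_to_tensor (of_int u * r + of_int v * s)"
      unfolding rs by (simp add: base.hom_simps base_int)
    finally have "gcd n m \<in> I" using n by (auto simp: I_def)
    then have "n \<le> gcd n m" unfolding n_def by (rule Least_le)
    then have "gcd n m = n" using n by (simp add: I_def antisym gcd_le1_nat)
    then have "n dvd m" by (metis gcd_dvd2)
    then have "p dvd m" using p(2) by (rule dvd_trans[rotated])
    then show False using m(2) p(1) by (meson coprime_def dvd_refl not_prime_unit)
  qed
  then show "z \<in> range base_to_tensor" using n by (simp add: I_def)
qed (auto simp: base_to_tensor_p_local)

text \<open>A denominator n prime to p can be removed by Bezout for n and p^k; injectivity brings
  the cleared equation back to R.\<close>

lemma of_nat_power_dvd_iff_multiples:
  fixes r :: "'a::{comm_ring_1, ring_char_0}"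
  assumes inj: "inj (base_to_tensor :: 'a \<Rightarrow> 'a tensor_rat)"
  shows "of_nat (p ^ k) dvd r \<longleftrightarrow> base_to_tensor r \<in> multiples (p ^ k) (p_local p)"
proof
  interpret base: unital_hom "base_to_tensor :: 'a \<Rightarrow> _" by (rule base_to_tensor_hom_unital)
  assume "of_nat (p ^ k) dvd r"
  then obtain s where "r = of_nat (p ^ k) * s" by (rule dvdE)
  then show "base_to_tensor r \<in> multiples (p ^ k) (p_local p)"
    by (intro multiplesI[OF base_to_tensor_p_local[of s]]) (simp only: base.hom_mult base.hom_of_nat)
next
  interpret base: unital_hom "base_to_tensor :: 'a \<Rightarrow> _" by (rule base_to_tensor_hom_unital)
  assume "base_to_tensor r \<in> multiples (p ^ k) (p_local p)"
  then obtain z where z: "z \<in> p_local p" "base_to_tensor r = of_nat (p ^ k) * z" by (rule multiplesE)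
  then obtain n s where n: "coprime n p" "of_nat n * z = base_to_tensor s"
    by (auto simp: p_local_iff)
  have "base_to_tensor (of_nat n * r) = base_to_tensor (of_nat (p ^ k) * s)"
    by (simp only: base.hom_mult base.hom_of_nat z(2) n(2)[symmetric] mult.left_commute)
  then have ns: "of_nat n * r = of_nat (p ^ k) * s" using inj by (simp add: inj_eq)
  obtain u v where uv: "u * int n + v * int (p ^ k) = 1"
    using n(1) bezout_int[of "int n" "int (p ^ k)"]
    by (metis coprime_imp_gcd_eq_1 coprime_int_iff coprime_power_right_iff)
  have "r = of_int (u * int n + v * int (p ^ k)) * r" unfolding uv by simp
  also have "\<dots> = of_int u * (of_nat n * r) + of_nat (p ^ k) * (of_int v * r)"
    by (simp add: algebra_simps)
  also have "\<dots> = of_nat (p ^ k) * (of_int u * s + of_int v * r)"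
    unfolding ns by (simp add: algebra_simps)
  finally show "of_nat (p ^ k) dvd r" by (rule dvdI)
qed

section \<open>Recursion for the \<open>p\<close>-sequence\<close>

text \<open>Splits off the last entry m of a tuple, which is positive, while n' stands for the
  concatenation of the others and may be 0.\<close>

definition digit_splits :: "nat \<Rightarrow> nat \<Rightarrow> (nat \<times> nat) set" where
  "digit_splits p n = {(n', m). m > 0 \<and> digit_concat p n' m = n}"

lemma digit_concat_0 [simp]: "digit_concat p n 0 = n"
  by (simp add: digit_concat_def)

lemma finite_digit_splits:
  assumes "p > 1"
  shows "finite (digit_splits p n)"
proof (rule finite_subset)
  show "digit_splits p n \<subseteq> {..n} \<times> {..n}"
  proof
    fix q assume "q \<in> digit_splits p n"
    then have "n = fst q + snd q * p ^ digit_length p (fst q)"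
      by (auto simp: digit_splits_def digit_concat_def)
    moreover have "snd q * 1 \<le> snd q * p ^ digit_length p (fst q)"
      using assms by (intro mult_le_mono2) simp
    ultimately have "fst q \<le> n" "snd q \<le> n" by linarith+
    then show "q \<in> {..n} \<times> {..n}" by (cases q) auto
  qed
qed simp

lemma digit_splits_eqD:
  assumes p: "p > 1" and "digit_concat p n m = N"
  shows "n = N mod p ^ digit_length p n" and "m = N div p ^ digit_length p n"
  using digit_length_props(2)[OF p, of n] assms by (auto simp: digit_concat_def)

lemma foldr_digit_concat_pos:
  assumes "p > 1" "ns \<noteq> []" "\<forall>m\<in>set ns. m > 0"
  shows "foldr (digit_concat p) ns 0 > 0"
  using assms by (cases ns) (auto simp: digit_concat_def)

text \<open>Pulls the last entry out of a right fold. Associativity needs a positive middle operand,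
  hence the condition on \<open>tl ns\<close>.\<close>

lemma foldr_digit_concat_snoc:
  assumes p: "p > 1" and "ns \<noteq> []" "\<forall>m\<in>set (tl ns). m > 0"
  shows "foldr (digit_concat p) ns m = digit_concat p (foldr (digit_concat p) ns 0) m"
    and "digit_length p (foldr (digit_concat p) ns 0) = sum_list (map (digit_length p) ns)"
  using assms(2,3)
proof (induction ns)
  case (Cons n ns)
  {
    case 1
    show ?case
    proof (cases "ns = []")
      case False
      then show ?thesis
        using Cons.IH(1) 1 foldr_digit_concat_pos[OF p, of ns] digit_concat_assoc[OF p]
        by (cases ns) auto
    qed simp
  next
    case 2
    show ?case
    proof (cases "ns = []")
      case False
      then show ?thesis
        using Cons.IH(2) 2 foldr_digit_concat_pos[OF p, of ns] digit_length_concat[OF p]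
        by (cases ns) auto
    qed simp
  }
qed simp_all

text \<open>Group the tuples of length at least 2 by their last entry m and the concatenation n' of
  the rest. Appending m flips the sign and multiplies by b_m twisted by the length of n', since
  lengths add under concatenation.\<close>

lemma p_sequence_rec:
  fixes b :: "nat \<Rightarrow> 'a::comm_ring_1"
  assumes p: "p > 1"
  shows "p_sequence p \<sigma> b n = b n -
    (\<Sum>(n', m)\<in>digit_splits p n. p_sequence p \<sigma> b n' * (\<sigma> ^^ digit_length p n') (b m))"
proof -
  define w where "w ns = (- 1) ^ (length ns - 1) *
     (\<Prod>i<length ns. (\<sigma> ^^ (\<Sum>j<i. digit_length p (ns ! j))) (b (ns ! i)))" for ns
  have w_snoc: "w (ns @ [m]) = - (w ns * (\<sigma> ^^ digit_length p n') (b m))"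
    if "ns \<in> concat_tuples p n'" for ns m n'
  proof -
    have ns: "ns \<noteq> []" "\<forall>m\<in>set (tl ns). m > 0" "foldr (digit_concat p) ns 0 = n'"
      using that by (auto simp: concat_tuples_def)
    have "(\<Sum>j<length ns. digit_length p ((ns @ [m]) ! j)) = (\<Sum>j<length ns. digit_length p (ns ! j))"
      by (intro sum.cong) (auto simp: nth_append)
    also have "\<dots> = digit_length p n'"
      using foldr_digit_concat_snoc(2)[OF p ns(1,2)] ns(3)
      by (simp add: sum_list_sum_nth atLeast0LessThan)
    finally have len: "(\<Sum>j<length ns. digit_length p ((ns @ [m]) ! j)) = digit_length p n'" .
    have "(\<Prod>i<length ns. (\<sigma> ^^ (\<Sum>j<i. digit_length p ((ns @ [m]) ! j))) (b ((ns @ [m]) ! i))) =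
        (\<Prod>i<length ns. (\<sigma> ^^ (\<Sum>j<i. digit_length p (ns ! j))) (b (ns ! i)))"
      by (intro prod.cong refl arg_cong2[of _ _ _ _ "\<lambda>k x. (\<sigma> ^^ k) x"] sum.cong)
        (auto simp: nth_append)
    moreover have "(- 1 :: 'a) ^ length ns = - ((- 1) ^ (length ns - 1))"
      using ns(1) by (cases ns) auto
    ultimately show ?thesis
      by (simp add: w_def len)
  qed
  let ?T = "SIGMA q:digit_splits p n. concat_tuples p (fst q)"
  let ?snoc = "\<lambda>(q, ns). ns @ [snd q]"
  have split: "concat_tuples p n = insert [n] (?snoc ` ?T)"
  proof (intro set_eqI iffI)
    fix ns assume ns: "ns \<in> concat_tuples p n"
    then obtain ms m where ms: "ns = ms @ [m]"
      by (cases ns rule: rev_cases) (auto simp: concat_tuples_def)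
    show "ns \<in> insert [n] (?snoc ` ?T)"
    proof (cases "ms = []")
      case True
      then show ?thesis using ns ms by (auto simp: concat_tuples_def)
    next
      case False
      let ?n' = "foldr (digit_concat p) ms 0"
      have pos: "\<forall>m\<in>set (tl ms). m > 0" "m > 0" and fold: "foldr (digit_concat p) ms m = n"
        using ns False by (auto simp: concat_tuples_def ms)
      then have "(?n', m) \<in> digit_splits p n" "ms \<in> concat_tuples p ?n'"
        using foldr_digit_concat_snoc(1)[OF p False pos(1), of m] False
        by (auto simp: digit_splits_def concat_tuples_def)
      then have "((?n', m), ms) \<in> ?T" by simp
      then show ?thesis unfolding ms by (intro insertI2 image_eqI[of _ _ "((?n', m), ms)"]) simp_all
    qed
  next
    fix ns assume "ns \<in> insert [n] (?snoc ` ?T)"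
    then show "ns \<in> concat_tuples p n"
    proof
      assume "ns \<in> ?snoc ` ?T"
      then obtain n' m ms where "(n', m) \<in> digit_splits p n" "ms \<in> concat_tuples p n'" "ns = ms @ [m]"
        by auto
      then show ?thesis
        using foldr_digit_concat_snoc(1)[OF p, of ms m]
        by (auto simp: digit_splits_def concat_tuples_def)
    qed (simp add: concat_tuples_def)
  qed
  have inj: "inj_on ?snoc ?T"
  proof (rule inj_onI)
    fix x y assume "x \<in> ?T" "y \<in> ?T" "?snoc x = ?snoc y"
    then show "x = y" by (auto simp: concat_tuples_def)
  qed
  have "[n] \<notin> ?snoc ` ?T" by (auto simp: concat_tuples_def)
  moreover have fin: "finite ?T"
    by (intro finite_SigmaI finite_digit_splits finite_concat_tuples p)
  ultimately have "p_sequence p \<sigma> b n = w [n] + (\<Sum>x\<in>?T. w (?snoc x))"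
    unfolding p_sequence_def w_def[symmetric] split by (simp add: sum.reindex[OF inj])
  also have "(\<Sum>x\<in>?T. w (?snoc x)) = (\<Sum>q\<in>digit_splits p n. \<Sum>ns\<in>concat_tuples p (fst q). w (ns @ [snd q]))"
    by (subst sum.Sigma) (simp_all add: finite_digit_splits[OF p] finite_concat_tuples[OF p] case_prod_unfold)
  also have "\<dots> = - (\<Sum>(n', m)\<in>digit_splits p n. p_sequence p \<sigma> b n' * (\<sigma> ^^ digit_length p n') (b m))"
    unfolding sum_negf[symmetric]
  proof (rule sum.cong[OF refl])
    fix q assume "q \<in> digit_splits p n"
    obtain n' m where q: "q = (n', m)" by (cases q)
    have "(\<Sum>ns\<in>concat_tuples p n'. w (ns @ [m])) =
        - ((\<Sum>ns\<in>concat_tuples p n'. w ns) * (\<sigma> ^^ digit_length p n') (b m))"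
      by (simp add: w_snoc sum_negf sum_distrib_right)
    then show "(\<Sum>ns\<in>concat_tuples p (fst q). w (ns @ [snd q])) =
        - (case q of (n', m) \<Rightarrow> p_sequence p \<sigma> b n' * (\<sigma> ^^ digit_length p n') (b m))"
      by (simp add: q p_sequence_def w_def)
  qed
  finally show ?thesis by (simp add: w_def case_prod_unfold)
qed

section \<open>Splittings of \<open>m * p ^ k - 1\<close> and the defect\<close>

lemma digit_length_power_minus_1:
  assumes "p > 1" "i > 0"
  shows "digit_length p (p ^ i - 1) = i"
proof (rule antisym)
  have "p ^ i > 0" using assms by simp
  then show "digit_length p (p ^ i - 1) \<le> i"
    using assms by (intro digit_length_props(3)) auto
  have "p ^ i - 1 < p ^ digit_length p (p ^ i - 1)"
    by (rule digit_length_props(2)[OF assms(1)])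
  then have "p ^ i \<le> p ^ digit_length p (p ^ i - 1)" by simp
  then show "i \<le> digit_length p (p ^ i - 1)" using assms(1) by simp
qed

text \<open>The lowest k digits of m p^k - 1 all equal p - 1, so its lowest i digits form p^i -
  1.\<close>

lemma digit_concat_power_minus_1:
  assumes "p > 1" "i > 0" "i \<le> k" "m > 0"
  shows "digit_concat p (p ^ i - 1) (m * p ^ (k - i) - 1) = m * p ^ k - 1"
proof -
  have "p ^ k = p ^ (k - i) * p ^ i" using assms(3) by (simp flip: power_add)
  moreover have "p ^ i > 0" "m * p ^ (k - i) > 0" using assms by simp_all
  then have "p ^ i \<ge> 1" "1 * p ^ i \<le> m * p ^ (k - i) * p ^ i"
    by (auto intro!: mult_le_mono1 simp del: mult_pos_pos)
  then have "p ^ i - 1 + (m * p ^ (k - i) - 1) * p ^ i = m * p ^ (k - i) * p ^ i - 1"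
    unfolding diff_mult_distrib by linarith
  ultimately show ?thesis
    unfolding digit_concat_def digit_length_power_minus_1[OF assms(1,2)] by (simp add: mult.assoc)
qed

text \<open>A cut at position s \<le> k is \<open>low\<close>. For s > k, the sum n' + 1 + m' p^s =
  m p^k shows n' + 1 = u p^k with u < m; u = 1 would force the length of n' to be k.\<close>

lemma digit_splits_cases:
  assumes p: "p > 1" and k: "k > 0" and m: "m > 0" and q: "q \<in> digit_splits p (m * p ^ k - 1)"
  obtains (low) i where "i \<in> {1..k}" "q = (p ^ i - 1, m * p ^ (k - i) - 1)"
  | (high) u where "1 < u" "u < m" "fst q = u * p ^ k - 1"
proof -
  obtain n' m' where nm: "q = (n', m')" "m' > 0" "digit_concat p n' m' = m * p ^ k - 1"
    using q by (auto simp: digit_splits_def)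
  define s where "s = digit_length p n'"
  have s: "s \<ge> 1" "n' < p ^ s" and eq: "n' + m' * p ^ s = m * p ^ k - 1"
    using digit_length_props(1,2)[OF p, of n'] nm(3) by (auto simp: s_def digit_concat_def)
  show thesis
  proof (cases "s \<le> k")
    case True
    have "digit_concat p (p ^ s - 1) (m * p ^ (k - s) - 1) = m * p ^ k - 1"
      using s True m by (intro digit_concat_power_minus_1 p) auto
    moreover have "digit_length p (p ^ s - 1) = s"
      using s by (intro digit_length_power_minus_1 p) auto
    ultimately have "q = (p ^ s - 1, m * p ^ (k - s) - 1)"
      using digit_splits_eqD[OF p nm(3)] digit_splits_eqD[OF p, of "p ^ s - 1" "m * p ^ (k - s) - 1"]
      by (simp add: nm(1) flip: s_def)
    then show thesis using low True s by auto
  next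
    case False
    let ?u = "m - m' * p ^ (s - k)"
    have ps: "p ^ s = p ^ (s - k) * p ^ k" using False by (simp flip: power_add)
    have mp: "m * p ^ k > 0" using m p by simp
    have "n' + 1 + m' * p ^ (s - k) * p ^ k = m * p ^ k"
      using eq mp by (simp add: ps mult.assoc)
    then have n': "n' + 1 = ?u * p ^ k"
      by (simp add: diff_mult_distrib)
    have "?u > 0" using n' by (cases "?u = 0") auto
    moreover have "?u \<noteq> 1"
    proof
      assume "?u = 1"
      then have "n' = p ^ k - 1" using n' by simp
      then have "s = k" using digit_length_power_minus_1[OF p k] by (simp add: s_def)
      with False show False by simp
    qed
    moreover have "m' * p ^ (s - k) > 0" using nm(2) p by simp
    ultimately have "1 < ?u" "?u < m" by linarith+
    moreover have "fst q = ?u * p ^ k - 1" using n' nm(1) by simp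
    ultimately show thesis by (rule high)
  qed
qed

text \<open>The part of the recursion at m p^k - 1 coming from \<open>low\<close> splits. Up to a
  factor it is a coefficient of the functional equation, see
  \<open>log_series_defect\<close>.\<close>

definition p_defect :: "nat \<Rightarrow> ('a \<Rightarrow> 'a) \<Rightarrow> (nat \<Rightarrow> 'a::comm_ring_1) \<Rightarrow> nat \<Rightarrow> nat \<Rightarrow> 'a" where
  "p_defect p \<sigma> b m k = b (m * p ^ k - 1) -
     (\<Sum>i=1..k. p_sequence p \<sigma> b (p ^ i - 1) * (\<sigma> ^^ i) (b (m * p ^ (k - i) - 1)))"

lemma inj_on_power_minus_1:
  assumes "p > (1::nat)"
  shows "inj_on (\<lambda>i. (p ^ i - 1, g i)) A"
proof (rule inj_onI)
  fix i j assume "(p ^ i - 1, g i) = (p ^ j - 1, g j)"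
  moreover have "p ^ i > 0" "p ^ j > 0" using assms by simp_all
  ultimately have "p ^ i = p ^ j" by (metis Pair_inject Suc_diff_1)
  then show "i = j" using assms by simp
qed

text \<open>The summand i = k is c at p^k - 1 itself because b_0 = 1, and the recursion expresses it
  by the others. This mirrors the exact functional equation at powers of p.\<close>

lemma p_defect_1:
  fixes b :: "nat \<Rightarrow> 'a::comm_ring_1"
  assumes p: "p > 1" and k: "k > 0" and \<sigma>: "unital_hom \<sigma>" and b: "b 0 = 1"
  shows "p_defect p \<sigma> b 1 k = 0"
proof -
  let ?g = "\<lambda>i. (p ^ i - 1, p ^ (k - i) - 1)"
  have "digit_splits p (1 * p ^ k - 1) = ?g ` {1..<k}"
  proof (intro set_eqI iffI)
    fix q assume q: "q \<in> digit_splits p (1 * p ^ k - 1)"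
    from p k zero_less_one q show "q \<in> ?g ` {1..<k}"
    proof (cases rule: digit_splits_cases)
      case (low i)
      \<comment> \<open>For i = k the last entry would be p^0 - 1 = 0, which
        \<open>digit_splits\<close> excludes.\<close>
      then have "i \<noteq> k" using q by (auto simp: digit_splits_def)
      with low show ?thesis by auto
    qed simp
  next
    fix q assume "q \<in> ?g ` {1..<k}"
    then obtain i where i: "1 \<le> i" "i < k" "q = ?g i" by auto
    moreover have "1 < p ^ (k - i)" using i p by (intro one_less_power) auto
    ultimately show "q \<in> digit_splits p (1 * p ^ k - 1)"
      using digit_concat_power_minus_1[OF p, of i k 1] by (simp add: digit_splits_def)
  qed
  moreover have "(\<Sum>(n', m)\<in>?g ` {1..<k}. p_sequence p \<sigma> b n' * (\<sigma> ^^ digit_length p n') (b m)) =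
      (\<Sum>i\<in>{1..<k}. p_sequence p \<sigma> b (p ^ i - 1) * (\<sigma> ^^ i) (b (p ^ (k - i) - 1)))"
    unfolding sum.reindex[OF inj_on_power_minus_1[OF p]] o_def case_prod_conv
    by (intro sum.cong refl) (subst digit_length_power_minus_1[OF p], auto)
  ultimately have "p_sequence p \<sigma> b (p ^ k - 1) = b (p ^ k - 1) -
      (\<Sum>i\<in>{1..<k}. p_sequence p \<sigma> b (p ^ i - 1) * (\<sigma> ^^ i) (b (p ^ (k - i) - 1)))"
    using p_sequence_rec[OF p, of \<sigma> b "p ^ k - 1"] by simp
  moreover have "{1..k} = insert k {1..<k}" using k by auto
  moreover have "(\<sigma> ^^ k) 1 = 1"
    using unital_hom.hom_one[OF unital_hom_funpow[OF \<sigma>]] by blast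
  ultimately show ?thesis by (simp add: p_defect_def b)
qed

text \<open>The remaining set Q consists of \<open>high\<close> splits, whose first components u p^k
  - 1 with 1 < u < m prepare an induction on m.\<close>

lemma p_sequence_eq_defect:
  fixes b :: "nat \<Rightarrow> 'a::comm_ring_1"
  assumes p: "p > 1" and k: "k > 0" and m: "m > 1"
  shows "\<exists>Q. (\<forall>q\<in>Q. \<exists>u. 1 < u \<and> u < m \<and> fst q = u * p ^ k - 1) \<and>
    p_sequence p \<sigma> b (m * p ^ k - 1) = p_defect p \<sigma> b m k -
      (\<Sum>(n', m')\<in>Q. p_sequence p \<sigma> b n' * (\<sigma> ^^ digit_length p n') (b m'))"
proof -
  let ?g = "\<lambda>i. (p ^ i - 1, m * p ^ (k - i) - 1)"
  let ?D = "digit_splits p (m * p ^ k - 1)"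
  let ?h = "\<lambda>(n', m'). p_sequence p \<sigma> b n' * (\<sigma> ^^ digit_length p n') (b m')"
  define Q where "Q = ?D - ?g ` {1..k}"
  have sub: "?g ` {1..k} \<subseteq> ?D"
  proof
    fix q assume "q \<in> ?g ` {1..k}"
    then obtain i where i: "1 \<le> i" "i \<le> k" "q = ?g i" by auto
    moreover have "1 < m * p ^ (k - i)"
      using m p by (metis less_le_trans mult_le_mono2 nat_mult_1_right one_le_power less_imp_le)
    ultimately show "q \<in> ?D"
      using digit_concat_power_minus_1[OF p, of i k m] m by (simp add: digit_splits_def)
  qed
  have "sum ?h ?D = sum ?h Q + sum ?h (?g ` {1..k})"
    unfolding Q_def by (rule sum.subset_diff[OF sub finite_digit_splits[OF p]])
  also have "sum ?h (?g ` {1..k}) =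
      (\<Sum>i=1..k. p_sequence p \<sigma> b (p ^ i - 1) * (\<sigma> ^^ i) (b (m * p ^ (k - i) - 1)))"
    unfolding sum.reindex[OF inj_on_power_minus_1[OF p]] o_def case_prod_conv
    by (intro sum.cong refl) (subst digit_length_power_minus_1[OF p], auto)
  finally have "p_sequence p \<sigma> b (m * p ^ k - 1) = p_defect p \<sigma> b m k - sum ?h Q"
    using p_sequence_rec[OF p, of \<sigma> b "m * p ^ k - 1"] by (simp add: p_defect_def)
  moreover have "\<exists>u. 1 < u \<and> u < m \<and> fst q = u * p ^ k - 1" if "q \<in> Q" for q
  proof -
    have "m > 0" "q \<in> ?D" using m that by (auto simp: Q_def)
    from p k this show ?thesis
      using that by (cases rule: digit_splits_cases) (auto simp: Q_def)
  qed
  ultimately show ?thesis by blast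
qed

text \<open>For fixed k, strong induction on m: the correction terms contain p-sequence values at u
  p^k - 1 with 1 < u < m, already divisible by p^k.\<close>

lemma p_sequence_dvd_iff:
  fixes b :: "nat \<Rightarrow> 'a::comm_ring_1"
  assumes p: "p > 1"
  shows "(\<forall>m>1. of_nat (p ^ k) dvd p_sequence p \<sigma> b (m * p ^ k - 1)) \<longleftrightarrow>
    (\<forall>m>1. of_nat (p ^ k) dvd p_defect p \<sigma> b m k)"
proof (cases "k = 0")
  case False
  then have k: "k > 0" by simp
  let ?d = "of_nat (p ^ k) :: 'a"
  have step: "?d dvd p_sequence p \<sigma> b (m * p ^ k - 1) \<longleftrightarrow> ?d dvd p_defect p \<sigma> b m k"
    if m: "m > 1" and IH: "\<And>u. 1 < u \<Longrightarrow> u < m \<Longrightarrow> ?d dvd p_sequence p \<sigma> b (u * p ^ k - 1)" for m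
  proof -
    obtain Q where Q: "\<forall>q\<in>Q. \<exists>u. 1 < u \<and> u < m \<and> fst q = u * p ^ k - 1"
      "p_sequence p \<sigma> b (m * p ^ k - 1) = p_defect p \<sigma> b m k -
      (\<Sum>(n', m')\<in>Q. p_sequence p \<sigma> b n' * (\<sigma> ^^ digit_length p n') (b m'))"
      using p_sequence_eq_defect[OF p k m, of \<sigma> b] by blast
    have "?d dvd (\<Sum>(n', m')\<in>Q. p_sequence p \<sigma> b n' * (\<sigma> ^^ digit_length p n') (b m'))"
    proof (rule dvd_sum)
      fix q assume "q \<in> Q"
      then obtain u where "1 < u" "u < m" "fst q = u * p ^ k - 1" using Q(1) by blast
      then show "?d dvd (case q of (n', m') \<Rightarrow> p_sequence p \<sigma> b n' * (\<sigma> ^^ digit_length p n') (b m'))"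
        using IH[of u] by (auto simp: case_prod_unfold)
    qed
    then show ?thesis unfolding Q(2) by (rule dvd_diff_left_iff)
  qed
  show ?thesis
  proof
    assume *: "\<forall>m>1. ?d dvd p_defect p \<sigma> b m k"
    have "m > 1 \<longrightarrow> ?d dvd p_sequence p \<sigma> b (m * p ^ k - 1)" for m
    proof (induction m rule: less_induct)
      case (less m)
      then show ?case using step[of m] * by blast
    qed
    then show "\<forall>m>1. ?d dvd p_sequence p \<sigma> b (m * p ^ k - 1)" by blast
  qed (use step in blast)
qed simp

section \<open>The criterion at a single prime\<close>

lemma log_series_scaled:
  fixes b :: "nat \<Rightarrow> 'a::{comm_ring_1, ring_char_0}"
  assumes "unital_hom \<sigma>" "n > 0"
  shows "of_nat n * (tensor_map \<sigma> ^^ i) (log_series b $ n) = base_to_tensor ((\<sigma> ^^ i) (b (n - 1)))"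
proof -
  have "(tensor_map \<sigma> ^^ i) (tensor_frac r n) = tensor_frac ((\<sigma> ^^ i) r) n" for r
    using assms by (induction i) (simp_all add: tensor_map_frac)
  then show ?thesis
    using assms by (simp add: log_series_def of_nat_mult_tensor_frac)
qed

text \<open>In m p^k = p * p^(i-1) * (m p^(k-i)), the last factor clears the denominator of the
  coefficient of f and the middle one turns w_i into the p-sequence value. Requiring this relation
  only for i \<le> k permits its use inside an induction.\<close>

lemma log_series_defect:
  fixes b :: "nat \<Rightarrow> 'a::{comm_ring_1, ring_char_0}"
  assumes \<sigma>: "unital_hom \<sigma>" and p: "p > 1" and m: "m > 0"
    and w: "\<And>i. 0 < i \<Longrightarrow> i \<le> k \<Longrightarrow>
      base_to_tensor (p_sequence p \<sigma> b (p ^ i - 1)) = of_nat (p ^ (i - 1)) * w i"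
  shows "of_nat (m * p ^ k) * (of_nat p * log_series b $ (p ^ k * m) -
      (\<Sum>i=1..k. w i * (tensor_map \<sigma> ^^ i) (log_series b $ (p ^ (k - i) * m)))) =
    of_nat p * base_to_tensor (p_defect p \<sigma> b m k)"
proof -
  interpret base: unital_hom "base_to_tensor :: 'a \<Rightarrow> _" by (rule base_to_tensor_hom_unital)
  let ?f = "log_series b"
  have nth: "of_nat (m * p ^ j) * (tensor_map \<sigma> ^^ i) (?f $ (p ^ j * m)) =
      base_to_tensor ((\<sigma> ^^ i) (b (m * p ^ j - 1)))" for i j
    using log_series_scaled[OF \<sigma>, of "m * p ^ j" i b] m p by (simp add: mult.commute)
  have "of_nat (m * p ^ k) * (w i * (tensor_map \<sigma> ^^ i) (?f $ (p ^ (k - i) * m))) =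
      of_nat p * base_to_tensor (p_sequence p \<sigma> b (p ^ i - 1) * (\<sigma> ^^ i) (b (m * p ^ (k - i) - 1)))"
    if "i \<in> {1..k}" for i
  proof -
    have "m * p ^ k = p * p ^ (i - 1) * (m * p ^ (k - i))"
      using that by (cases i) (simp_all add: mult.left_commute flip: power_add power_Suc)
    then have "of_nat (m * p ^ k) * (w i * (tensor_map \<sigma> ^^ i) (?f $ (p ^ (k - i) * m))) =
        of_nat p * (of_nat (p ^ (i - 1)) * w i) *
        (of_nat (m * p ^ (k - i)) * (tensor_map \<sigma> ^^ i) (?f $ (p ^ (k - i) * m)))"
      by (simp only: of_nat_mult mult_ac)
    then show ?thesis
      using w[of i] that unfolding nth by (simp add: base.hom_mult)
  qed
  then have "(\<Sum>i=1..k. of_nat (m * p ^ k) * (w i * (tensor_map \<sigma> ^^ i) (?f $ (p ^ (k - i) * m)))) =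
      of_nat p * base_to_tensor (\<Sum>i=1..k. p_sequence p \<sigma> b (p ^ i - 1) * (\<sigma> ^^ i) (b (m * p ^ (k - i) - 1)))"
    by (simp add: base.hom_sum sum_distrib_left)
  moreover have "of_nat (m * p ^ k) * (of_nat p * ?f $ (p ^ k * m)) = of_nat p * base_to_tensor (b (m * p ^ k - 1))"
    using nth[of k 0] by (simp only: funpow.simps id_apply mult.left_commute)
  ultimately show ?thesis
    unfolding right_diff_distrib sum_distrib_left p_defect_def base.hom_diff by simp
qed

lemma p_local_group_law_iff:
  fixes \<sigma> :: "'a::{comm_ring_1, ring_char_0} \<Rightarrow> 'a"
  assumes inj: "inj (base_to_tensor :: 'a \<Rightarrow> 'a tensor_rat)"
    and p: "prime p" and frob: "frobenius_lift p \<sigma>" and b: "b 0 = 1"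
  shows "(\<forall>i j. formal_group_law (log_series b) $ j $ i \<in> p_local p) \<longleftrightarrow>
    (\<forall>m k. m > 1 \<longrightarrow> of_nat (p ^ k) dvd p_sequence p \<sigma> b (m * p ^ k - 1))"
    (is "?L \<longleftrightarrow> ?R")
proof -
  interpret K: frob_ring "p_local p :: 'a tensor_rat set" "tensor_map \<sigma>" p
    by (rule frob_ring_p_local[OF p frob])
  interpret \<sigma>: unital_hom \<sigma> by (rule unital_hom_frobenius_lift[OF frob])
  interpret base: unital_hom "base_to_tensor :: 'a \<Rightarrow> _" by (rule base_to_tensor_hom_unital)
  let ?f = "log_series b" and ?O = "p_local p :: 'a tensor_rat set"
  let ?F = "fps_homog (formal_group_law ?f)"
  let ?c = "\<lambda>i. p_sequence p \<sigma> b (p ^ i - 1)" and ?\<phi> = "tensor_map \<sigma>"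
  note defect = log_series_defect[OF \<sigma>.unital_hom_axioms K.p_gt_1]
  note dvd_iff = of_nat_power_dvd_iff_multiples[OF inj]
  have f: "?f $ 0 = 0" "?f $ 1 = 1"
    using log_series_0[of b] log_series_1[of b] b by blast+
  have nf: "of_nat n * ?f $ n \<in> ?O" for n
    using log_series_scaled[OF \<sigma>.unital_hom_axioms, of n 0 b] K.zero_in
    by (cases "n = 0") (simp_all add: base_to_tensor_p_local)
  have F: "?F $ 0 = 0" "fps_lift ?f oo ?F = xy_sum ?f"
    by (rule fps_homog_formal_group_law[OF f])+
  have L: "?L \<longleftrightarrow> ?F \<in> int_fps (int_fps ?O)"
    using fps_homog_int_iff[OF K.zero_in] by blast
  have R: "?R \<longleftrightarrow> (\<forall>m k. m > 1 \<longrightarrow> of_nat (p ^ k) dvd p_defect p \<sigma> b m k)"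
    using p_sequence_dvd_iff[OF K.p_gt_1] by blast
  show ?thesis
  proof
    assume ?L
    then have "K.log_pair ?f ?F"
      using f F nf L by (simp add: K.log_pair_def)
    then obtain w where w: "\<And>i. w i \<in> ?O" "K.local_functional_eq w ?f"
      and exact: "\<And>v. v > 0 \<Longrightarrow> of_nat p * ?f $ (p ^ v) = (\<Sum>i=1..v. w i * (?\<phi> ^^ i) (?f $ (p ^ (v - i))))"
      by (rule K.log_pair_local_functional_eq) blast
    have cw: "0 < k \<Longrightarrow> base_to_tensor (?c k) = of_nat (p ^ (k - 1)) * w k" for k
    proof (induction k rule: less_induct)
      case (less k)
      \<comment> \<open>The candidate for w_k always exists in \<open>R \<otimes> \<rat>\<close>.
        Replacing w_k by it makes \<open>defect\<close> applicable with m = 1; comparison with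
        \<open>exact\<close> then gives t = w_k, as f has linear coefficient 1.\<close>
      define t where "t = tensor_frac (?c k) (p ^ (k - 1))"
      define w' where "w' = w(k := t)"
      have ct: "base_to_tensor (?c k) = of_nat (p ^ (k - 1)) * t"
        unfolding t_def using K.p_pos by (subst of_nat_mult_tensor_frac) simp_all
      have w': "base_to_tensor (?c i) = of_nat (p ^ (i - 1)) * w' i" if "0 < i" "i \<le> k" for i
        using less.IH[of i] that ct by (cases "i = k") (auto simp: w'_def)
      have k: "{1..k} = insert k {1..<k}" using less.prems by auto
      have "of_nat (p ^ k) * (of_nat p * ?f $ (p ^ k) - (\<Sum>i=1..k. w' i * (?\<phi> ^^ i) (?f $ (p ^ (k - i))))) = 0"
        using defect[where m = 1 and k = k and w = w'] w' p_defect_1[where b = b, OF K.p_gt_1 less.prems \<sigma>.unital_hom_axioms b]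
        by (simp add: base.hom_zero)
      then have "of_nat p * ?f $ (p ^ k) - (\<Sum>i=1..k. w' i * (?\<phi> ^^ i) (?f $ (p ^ (k - i)))) = 0"
        by (rule tensor_torsion_free[rotated]) (use K.p_pos in simp)
      then have "(\<Sum>i=1..k. w' i * (?\<phi> ^^ i) (?f $ (p ^ (k - i)))) =
          (\<Sum>i=1..k. w i * (?\<phi> ^^ i) (?f $ (p ^ (k - i))))"
        using exact[OF less.prems] by simp
      moreover have "(?\<phi> ^^ k) 1 = 1"
        using unital_hom.hom_one[OF unital_hom_funpow[OF K.unital_hom_axioms]] .
      moreover have "(\<Sum>i\<in>{1..<k}. w' i * (?\<phi> ^^ i) (?f $ (p ^ (k - i)))) =
          (\<Sum>i\<in>{1..<k}. w i * (?\<phi> ^^ i) (?f $ (p ^ (k - i))))"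
        by (intro sum.cong) (auto simp: w'_def)
      ultimately have "t = w k"
        unfolding k using f(2) by (simp add: w'_def)
      then show ?case using ct by simp
    qed
    have "of_nat (p ^ k) dvd p_defect p \<sigma> b M k" if "M > 1" for M k
    proof -
      \<comment> \<open>M may be divisible by p, while the local equation concerns m prime to p; so
        the pair (M, k) is traded for (m, a + k).\<close>
      obtain a m where M: "M = p ^ a * m" "\<not> p dvd m"
        using multiplicity_decompose'[of M p] \<open>M > 1\<close> p by (metis not_prime_unit not_one_less_zero)
      then have m: "m > 0" "coprime m p"
        using p prime_imp_coprime[of p m] that by (auto simp: coprime_commute intro: gr0I)
      let ?v = "a + k"
      let ?X = "of_nat p * ?f $ (p ^ ?v * m) - (\<Sum>i=1..?v. w i * (?\<phi> ^^ i) (?f $ (p ^ (?v - i) * m)))"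
      have X: "of_nat (m * p ^ ?v) * ?X = of_nat p * base_to_tensor (p_defect p \<sigma> b m ?v)"
        by (rule defect[OF m(1) cw])
      have "?X \<in> multiples p ?O"
        using w(2) m by (simp add: K.local_functional_eq_def)
      then have "of_nat p * base_to_tensor (p_defect p \<sigma> b m ?v) \<in> multiples (m * p ^ ?v * p) ?O"
        unfolding X[symmetric]
        by (rule K.multiples_of_nat_mult)
      then have "of_nat p * base_to_tensor (p_defect p \<sigma> b m ?v) \<in> multiples (p * p ^ k) ?O"
        by (rule K.multiples_dvd) (simp add: power_add)
      then have 1: "base_to_tensor (p_defect p \<sigma> b m ?v) \<in> multiples (p ^ k) ?O"
        by (rule K.multiples_cancel[OF K.p_pos])
      have idx: "m * p ^ (?v - i) = M * p ^ (k - i)" if "i \<le> k" for i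
        using that by (simp add: M flip: power_add)
      have "{1..?v} = {1..k} \<union> {k<..?v}" "{1..k} \<inter> {k<..?v} = {}" by auto
      then have "(\<Sum>i=1..?v. ?c i * (\<sigma> ^^ i) (b (m * p ^ (?v - i) - 1))) =
          (\<Sum>i=1..k. ?c i * (\<sigma> ^^ i) (b (m * p ^ (?v - i) - 1))) +
          (\<Sum>i\<in>{k<..?v}. ?c i * (\<sigma> ^^ i) (b (m * p ^ (?v - i) - 1)))"
        by (simp add: sum.union_disjoint)
      also have "(\<Sum>i=1..k. ?c i * (\<sigma> ^^ i) (b (m * p ^ (?v - i) - 1))) =
          (\<Sum>i=1..k. ?c i * (\<sigma> ^^ i) (b (M * p ^ (k - i) - 1)))"
        by (intro sum.cong refl) (simp add: idx)
      finally have "p_defect p \<sigma> b M k = p_defect p \<sigma> b m ?v +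
          (\<Sum>i\<in>{k<..?v}. ?c i * (\<sigma> ^^ i) (b (m * p ^ (?v - i) - 1)))"
        using idx[of 0] by (simp add: p_defect_def)
      moreover have "base_to_tensor (?c i * (\<sigma> ^^ i) (b (m * p ^ (?v - i) - 1))) \<in> multiples (p ^ k) ?O"
        if "i \<in> {k<..?v}" for i
      proof -
        have "base_to_tensor (?c i) \<in> multiples (p ^ (i - 1)) ?O"
          using that by (intro multiplesI[OF w(1) cw]) simp
        \<comment> \<open>The two defects differ by summands with i > k. There i - 1 \<ge> k, so the
          factor p^(i-1) suffices.\<close>
        moreover have "p ^ k dvd p ^ (i - 1)"
          using that by (intro le_imp_power_dvd) auto
        ultimately show ?thesis
          unfolding base.hom_mult by (rule K.multiples_mult[OF K.multiples_dvd base_to_tensor_p_local])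
      qed
      ultimately have "base_to_tensor (p_defect p \<sigma> b M k) \<in> multiples (p ^ k) ?O"
        by (simp only: base.hom_add base.hom_sum) (intro K.multiples_add 1 K.multiples_sum)
      then show ?thesis by (simp only: dvd_iff)
    qed
    then show ?R unfolding R by blast
  next
    assume ?R
    \<comment> \<open>Integrality of w_i is the hypothesis at m = p, k = i - 1, because p^i - 1 = p
      * p^(i-1) - 1.\<close>
    have "\<exists>t. t \<in> ?O \<and> (0 < i \<longrightarrow> base_to_tensor (?c i) = of_nat (p ^ (i - 1)) * t)" for i
    proof (cases i)
      case (Suc j)
      have "of_nat (p ^ j) dvd ?c i"
        using \<open>?R\<close>[rule_format, of p j] K.p_gt_1 by (simp add: Suc)
      then have "base_to_tensor (?c i) \<in> multiples (p ^ j) ?O" by (simp only: dvd_iff)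
      then show ?thesis unfolding Suc diff_Suc_1 by (meson multiplesE)
    qed (use K.zero_in in auto)
    then obtain w where w: "\<And>i. w i \<in> ?O"
      "\<And>i. 0 < i \<Longrightarrow> base_to_tensor (?c i) = of_nat (p ^ (i - 1)) * w i"
      by metis
    have "K.local_functional_eq w ?f"
      unfolding K.local_functional_eq_def
    proof (intro allI impI)
      fix v m assume m: "m > 0" "coprime m p"
      let ?X = "of_nat p * ?f $ (p ^ v * m) - (\<Sum>i=1..v. w i * (?\<phi> ^^ i) (?f $ (p ^ (v - i) * m)))"
      have X: "of_nat (m * p ^ v) * ?X = of_nat p * base_to_tensor (p_defect p \<sigma> b m v)"
        by (rule defect[OF m(1) w(2)])
      show "?X \<in> multiples p ?O"
      \<comment> \<open>The hypothesis covers only m > 1. For m = 1 the claim follows from f_1 = 1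
        when v = 0 and from \<open>p_defect_1\<close> when v > 0.\<close>
      proof (cases "m = 1 \<and> v = 0")
        case True
        then show ?thesis using f(2) by (auto intro!: multiplesI[OF K.one_in])
      next
        case False
        have "of_nat (p ^ v) dvd p_defect p \<sigma> b m v"
        proof (cases "m = 1")
          case True
          then show ?thesis
            using False p_defect_1[where b = b, OF K.p_gt_1 _ \<sigma>.unital_hom_axioms b] by simp
        next
          case False
          then show ?thesis using \<open>?R\<close>[unfolded R] m(1) by simp
        qed
        then have "of_nat p * base_to_tensor (p_defect p \<sigma> b m v) \<in> multiples (p * p ^ v) ?O"
          unfolding dvd_iff by (rule K.multiples_of_nat_mult)
        then have "of_nat (p ^ v) * (of_nat m * ?X) \<in> multiples (p ^ v * p) ?O"
          unfolding X[symmetric] by (simp add: mult_ac)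
        then have "of_nat m * ?X \<in> multiples (p ^ 1) ?O"
          using K.multiples_cancel[of "p ^ v" _ p] K.p_pos by simp
        then show ?thesis using K.multiples_coprime[OF m(2), of ?X 1] by simp
      qed
    qed
    from K.local_functional_eq_imp_integral[OF f nf w(1) this F]
    show ?L unfolding L .
  qed
qed

theorem mainTheorem2:
  fixes \<sigma> :: "nat \<Rightarrow> 'a::{comm_ring_1, ring_char_0} \<Rightarrow> 'a"
    and b :: "nat \<Rightarrow> 'a"
  assumes "inj (base_to_tensor :: 'a \<Rightarrow> 'a tensor_rat)"
    and "\<And>p. prime p \<Longrightarrow> frobenius_lift p (\<sigma> p)"
    and "b 0 = 1"
  shows "(\<forall>i j. fps_nth (fps_nth (formal_group_law (log_series b)) j) i \<in> range base_to_tensor) \<longleftrightarrow>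
    (\<forall>p. prime p \<longrightarrow>
      (\<forall>m k. m > 1 \<longrightarrow> of_nat (p ^ k) dvd p_sequence p (\<sigma> p) b (m * p ^ k - 1)))"
proof -
  have "(\<forall>i j. formal_group_law (log_series b) $ j $ i \<in> range base_to_tensor) \<longleftrightarrow>
      (\<forall>p. prime p \<longrightarrow> (\<forall>i j. formal_group_law (log_series b) $ j $ i \<in> p_local p))"
    unfolding range_base_eq_Inter_p_local by blast
  also have "\<dots> \<longleftrightarrow> (\<forall>p. prime p \<longrightarrow>
      (\<forall>m k. m > 1 \<longrightarrow> of_nat (p ^ k) dvd p_sequence p (\<sigma> p) b (m * p ^ k - 1)))"
    using p_local_group_law_iff[where b = b, OF assms(1)] assms(2,3) by blast
  finally show ?thesis .
qed

end
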